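(* For every constant $c>0$ there is a polynomial-time algorithm and a constant $C>0$ such that, for every instance $(G,p,w)$ of weighted \texttt{MDD(max)} with $n$ vertices for which the set $L$ defined below satisfies $|L|\le c\log n$, the algorithm outputs a feasible solution whose weight is at most $C\log n$ times the minimum weight of a feasible solution. Here $L\subseteq N(p)$ is the set produced by the following procedure: start with $L=\emptyset$; while there exists a vertex $u\in N(p)\setminus L$ with $|N(u)\setminus L|\ge |N(p)\setminus L|$, add such a $u$ to $L$.
   Context: Weighted \texttt{MDD(max)}: given a finite simple undirected graph $G=(V,E)$, a distinguished vertex $p\in V$ and vertex weights $w:V\to\mathbb{Z}^+$, find a set $S\subseteq V\setminus\{p\}$ of minimum total weight such that $p$ is the unique vertex of maximum degree in the induced subgraph $G[V\setminus S]$ (such an $S$ is a feasible solution). $N(v)$ denotes the set of neighbours of $v$ in $G$. *)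

theory Defs
  imports Complex_Main "HOL-Library.Log_Nat" "HOL-Computational_Algebra.Polynomial"
begin

section \<open>Weighted MDD(max)\<close>

definition simple_graph :: "'a set \<Rightarrow> 'a set set \<Rightarrow> bool" where
  "simple_graph V E \<longleftrightarrow> finite V \<and> (\<forall>e\<in>E. e \<subseteq> V \<and> card e = 2)"

definition nbrs :: "'a set set \<Rightarrow> 'a \<Rightarrow> 'a set" where
  "nbrs E v = {u. {u, v} \<in> E}"

definition deg :: "'a set set \<Rightarrow> 'a \<Rightarrow> nat" where
  "deg E v = card (nbrs E v)"

definition induced_edges :: "'a set set \<Rightarrow> 'a set \<Rightarrow> 'a set set" where
  "induced_edges E W = {e \<in> E. e \<subseteq> W}"

definition max_degree_vertices :: "'a set \<Rightarrow> 'a set set \<Rightarrow> 'a set" where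
  "max_degree_vertices V E = {v \<in> V. \<forall>u\<in>V. deg E u \<le> deg E v}"

definition mdd_instance :: "'a set \<Rightarrow> 'a set set \<Rightarrow> 'a \<Rightarrow> ('a \<Rightarrow> nat) \<Rightarrow> bool" where
  "mdd_instance V E p w \<longleftrightarrow> simple_graph V E \<and> p \<in> V \<and> (\<forall>v\<in>V. 0 < w v)"

definition feasible :: "'a set \<Rightarrow> 'a set set \<Rightarrow> 'a \<Rightarrow> 'a set \<Rightarrow> bool" where
  "feasible V E p S \<longleftrightarrow>
     S \<subseteq> V - {p} \<and> max_degree_vertices (V - S) (induced_edges E (V - S)) = {p}"

text \<open>The set of feasible solutions of an instance is finite and contains \<open>V - {p}\<close>,
  so the minimum exists.\<close>

definition min_weight :: "'a set \<Rightarrow> 'a set set \<Rightarrow> 'a \<Rightarrow> ('a \<Rightarrow> nat) \<Rightarrow> nat" where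
  "min_weight V E p w = Min {sum w S | S. feasible V E p S}"

section \<open>The set L\<close>

definition can_add :: "'a set set \<Rightarrow> 'a \<Rightarrow> 'a set \<Rightarrow> 'a \<Rightarrow> bool" where
  "can_add E p L u \<longleftrightarrow> u \<in> nbrs E p - L \<and> card (nbrs E u - L) \<ge> card (nbrs E p - L)"

inductive L_reachable :: "'a set set \<Rightarrow> 'a \<Rightarrow> 'a set \<Rightarrow> bool" for E p where
  start: "L_reachable E p {}"
| add: "L_reachable E p L \<Longrightarrow> can_add E p L u \<Longrightarrow> L_reachable E p (insert u L)"

definition L_produced :: "'a set set \<Rightarrow> 'a \<Rightarrow> 'a set \<Rightarrow> bool" where
  "L_produced E p L \<longleftrightarrow> L_reachable E p L \<and> \<not> (\<exists>u. can_add E p L u)"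

text \<open>The procedure leaves the choice of the added vertex open, but its result does not
  depend on these choices.\<close>

lemma finite_nbrs: "simple_graph V E \<Longrightarrow> finite (nbrs E v)"
  by (rule finite_subset[of _ V]) (auto simp: simple_graph_def nbrs_def)

lemma L_reachable_subset: "L_reachable E p L \<Longrightarrow> L \<subseteq> nbrs E p"
  by (induction rule: L_reachable.induct) (auto simp: can_add_def)

lemma can_add_mono:
  assumes G: "simple_graph V E" and "can_add E p L u" "L \<subseteq> M" "M \<subseteq> nbrs E p" "u \<notin> M"
  shows "can_add E p M u"
proof -
  note fin = finite_nbrs[OF G]
  have fM: "finite M" using assms(4) fin finite_subset by blast
  have "card (nbrs E p - L) = card ((nbrs E p - M) \<union> (M - L))"
    using assms by (intro arg_cong[where f = card]) auto
  also have "\<dots> = card (nbrs E p - M) + card (M - L)"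
    using fin fM by (intro card_Un_disjoint) auto
  finally have 1: "card (nbrs E p - L) = card (nbrs E p - M) + card (M - L)" .
  have "card (nbrs E u - L) \<le> card ((nbrs E u - M) \<union> (M - L))"
    using fin fM by (intro card_mono) auto
  also have "\<dots> \<le> card (nbrs E u - M) + card (M - L)" by (rule card_Un_le)
  finally show ?thesis using 1 assms by (auto simp: can_add_def)
qed

lemma L_produced_unique:
  assumes G: "simple_graph V E" and "L_produced E p L" "L_produced E p M"
  shows "L = M"
proof -
  have "K \<subseteq> M'" if "L_reachable E p K" "L_produced E p M'" for K M'
    using that
  proof (induction rule: L_reachable.induct)
    case (add K u)
    then have "K \<subseteq> M'" "M' \<subseteq> nbrs E p" "\<not> can_add E p M' u"
      by (auto simp: L_produced_def L_reachable_subset)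
    with add.hyps(2) can_add_mono[OF G] have "u \<in> M'" by blast
    with \<open>K \<subseteq> M'\<close> show ?case by simp
  qed simp
  then show ?thesis using assms(2,3) by (auto simp: L_produced_def)
qed

section \<open>Programs and their running time\<close>

text \<open>
  The machine model is a structured random access machine. A program uses finitely many named
  arrays of natural numbers, indexed by natural numbers; the scalar variable \<open>x\<close> is the entry
  with index 0 of the array \<open>x\<close>. Subtraction is truncated.

  Every operation has unit cost. Since there is addition but no multiplication or shift,
  the bit length of the largest value (and index) grows by only a constant, depending on the
  program, per unit of time. Hence running time polynomial in the bit length of the input
  agrees with polynomial time on Turing machines.
\<close>

type_synonym vname = string
type_synonym state = "vname \<Rightarrow> nat \<Rightarrow> nat"

datatype aexp = Const nat | Read vname aexp | Plus aexp aexp | Minus aexp aexp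

datatype bexp = Less aexp aexp | Neg bexp | Conj bexp bexp

datatype com =
    Skip
  | Write vname aexp aexp
  | Seq com com
  | Cond bexp com com
  | While bexp com

primrec aval :: "aexp \<Rightarrow> state \<Rightarrow> nat" where
  "aval (Const k) s = k"
| "aval (Read x i) s = s x (aval i s)"
| "aval (Plus a b) s = aval a s + aval b s"
| "aval (Minus a b) s = aval a s - aval b s"

primrec bval :: "bexp \<Rightarrow> state \<Rightarrow> bool" where
  "bval (Less a b) s \<longleftrightarrow> aval a s < aval b s"
| "bval (Neg b) s \<longleftrightarrow> \<not> bval b s"
| "bval (Conj a b) s \<longleftrightarrow> bval a s \<and> bval b s"

primrec acost :: "aexp \<Rightarrow> nat" where
  "acost (Const k) = 1"
| "acost (Read x i) = 1 + acost i"
| "acost (Plus a b) = 1 + acost a + acost b"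
| "acost (Minus a b) = 1 + acost a + acost b"

primrec bcost :: "bexp \<Rightarrow> nat" where
  "bcost (Less a b) = 1 + acost a + acost b"
| "bcost (Neg b) = 1 + bcost b"
| "bcost (Conj a b) = 1 + bcost a + bcost b"

text \<open>\<open>exec c s t s'\<close>: program \<open>c\<close>, started in state \<open>s\<close>, halts after time \<open>t\<close> in state \<open>s'\<close>.
  \<open>Write x i a\<close> is the assignment \<open>x[i] := a\<close>.\<close>

inductive exec :: "com \<Rightarrow> state \<Rightarrow> nat \<Rightarrow> state \<Rightarrow> bool" where
  Skip: "exec Skip s 1 s"
| Write: "exec (Write x i a) s (1 + acost i + acost a)
            (s(x := (s x)(aval i s := aval a s)))"
| Seq: "exec c1 s t1 s1 \<Longrightarrow> exec c2 s1 t2 s2 \<Longrightarrow> exec (Seq c1 c2) s (t1 + t2) s2"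
| CondTrue: "bval b s \<Longrightarrow> exec c1 s t s' \<Longrightarrow> exec (Cond b c1 c2) s (1 + bcost b + t) s'"
| CondFalse: "\<not> bval b s \<Longrightarrow> exec c2 s t s' \<Longrightarrow> exec (Cond b c1 c2) s (1 + bcost b + t) s'"
| WhileFalse: "\<not> bval b s \<Longrightarrow> exec (While b c) s (1 + bcost b) s"
| WhileTrue: "bval b s \<Longrightarrow> exec c s t1 s1 \<Longrightarrow> exec (While b c) s1 t2 s2 \<Longrightarrow>
    exec (While b c) s (1 + bcost b + t1 + t2) s2"

inductive_cases exec_SkipE: "exec Skip s t s'"
inductive_cases exec_WriteE: "exec (Write x i a) s t s'"
inductive_cases exec_SeqE: "exec (Seq c1 c2) s t s'"
inductive_cases exec_CondE: "exec (Cond b c1 c2) s t s'"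
inductive_cases exec_WhileE: "exec (While b c) s t s'"

lemma exec_deterministic: "exec c s t s' \<Longrightarrow> exec c s t' s'' \<Longrightarrow> t = t' \<and> s' = s''"
proof (induction arbitrary: t' s'' rule: exec.induct)
  case (Skip s)
  then show ?case by (auto elim: exec_SkipE)
next
  case (Write x i a s)
  then show ?case by (auto elim: exec_WriteE)
next
  case (Seq c1 s t1 s1 c2 t2 s2)
  from Seq.prems show ?case
    by (rule exec_SeqE) (auto dest: Seq.IH)
next
  case (CondTrue b s c1 t s' c2)
  from CondTrue.prems show ?case
    by (rule exec_CondE) (use CondTrue.hyps in \<open>auto dest: CondTrue.IH\<close>)
next
  case (CondFalse b s c2 t s' c1)
  from CondFalse.prems show ?case
    by (rule exec_CondE) (use CondFalse.hyps in \<open>auto dest: CondFalse.IH\<close>)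
next
  case (WhileFalse b s c)
  from WhileFalse.prems show ?case
    by (rule exec_WhileE) (use WhileFalse.hyps in auto)
next
  case (WhileTrue b s c t1 s1 t2 s2)
  from WhileTrue.prems show ?case
    by (rule exec_WhileE) (use WhileTrue.hyps in \<open>auto dest: WhileTrue.IH\<close>)
qed

section \<open>Inputs and outputs\<close>

text \<open>An instance with \<open>n\<close> vertices has the vertex set \<open>{..<n}\<close> and is given to a program
  by the number \<open>n\<close>, the vertex \<open>p\<close>, the adjacency matrix in row-major order and
  the weights; everything else is initially 0.\<close>

definition input_state :: "nat \<Rightarrow> nat set set \<Rightarrow> nat \<Rightarrow> (nat \<Rightarrow> nat) \<Rightarrow> state" where
  "input_state n E p w = (\<lambda>x i.
     if x = ''n'' \<and> i = 0 then n
     else if x = ''p'' \<and> i = 0 then p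
     else if x = ''adj'' \<and> i < n * n \<and> {i div n, i mod n} \<in> E then 1
     else if x = ''w'' \<and> i < n then w i
     else 0)"

definition output_set :: "nat \<Rightarrow> state \<Rightarrow> nat set" where
  "output_set n s = {i. i < n \<and> s ''out'' i \<noteq> 0}"

text \<open>\<open>floorlog 2 k\<close> is the number of binary digits of \<open>k\<close>.\<close>

definition input_size :: "nat \<Rightarrow> nat \<Rightarrow> (nat \<Rightarrow> nat) \<Rightarrow> nat" where
  "input_size n p w = floorlog 2 n + floorlog 2 p + n * n + (\<Sum>i<n. floorlog 2 (w i))"

definition polynomial_time :: "com \<Rightarrow> bool" where
  "polynomial_time A \<longleftrightarrow>
     (\<exists>q :: nat poly. \<forall>n E p w. mdd_instance {..<n} E p w \<longrightarrow>
        (\<exists>t s. exec A (input_state n E p w) t s \<and> t \<le> poly q (input_size n p w)))"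

definition outputs :: "com \<Rightarrow> nat \<Rightarrow> nat set set \<Rightarrow> nat \<Rightarrow> (nat \<Rightarrow> nat) \<Rightarrow> nat set \<Rightarrow> bool" where
  "outputs A n E p w S \<longleftrightarrow> (\<exists>t s. exec A (input_state n E p w) t s \<and> output_set n s = S)"

end

theory Submission
  imports Defs
begin

text \<open>
  When the procedure has stopped at \<open>L\<close>, every vertex of \<open>N(p) - L\<close> has fewer neighbours outside
  \<open>L\<close> than \<open>p\<close>. Hence the vertices of \<open>N(p) - L\<close> can be removed from a feasible solution, and some
  optimal solution deletes only neighbours of \<open>p\<close> that are in \<open>L\<close>. The program tries all
  \<open>2 ^ card L\<close> sets \<open>T \<subseteq> L\<close> of deleted neighbours. Once \<open>T\<close> is fixed, so is the final degree \<open>d\<close> of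
  \<open>p\<close>, and what remains is a covering problem over the vertices outside \<open>N(p) \<union> {p}\<close>: every
  remaining vertex \<open>u\<close> must lose \<open>deg u + 1 - d\<close> neighbours or be deleted. The greedy algorithm,
  with the sum of the unmet demands as potential, costs at most \<open>1 + ln (n * n)\<close> times the optimum.
  The machine has no multiplication and no division, so products and halves are computed by counting
  loops, all of which run up to \<open>n\<close> or up to a fixed power of \<open>n\<close>.
\<close>

section \<open>A language of bounded loops\<close>

text \<open>Same effect as \<open>Write\<close>, under a name of its own so that updates can be
  swapped and merged by rewriting.\<close>

definition upd :: "state \<Rightarrow> vname \<Rightarrow> nat \<Rightarrow> nat \<Rightarrow> state" where
  "upd s x i a = s(x := (s x)(i := a))"

lemma upd_same [simp]: "upd s x i a x = (s x)(i := a)"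
  and upd_other [simp]: "y \<noteq> x \<Longrightarrow> upd s x i a y = s y"
  by (auto simp: upd_def)

lemma upd_swap: "x \<noteq> y \<Longrightarrow> upd (upd s x i a) y j b = upd (upd s y j b) x i a"
  by (auto simp: upd_def fun_upd_twist)

lemma upd_upd [simp]: "upd (upd s x i a) x i b = upd s x i b"
  by (simp add: upd_def)

text \<open>Every loop runs up to the value that its bound has on entry. Such programs always
  terminate, so they have a functional semantics, and a bound on their running time can be read off
  the syntax.\<close>

datatype lcom =
    LSkip
  | LWrite vname aexp aexp
  | LSeq lcom lcom  (infixr \<open>;;\<close> 60)
  | LCond bexp lcom lcom
  | LFor vname vname lcom

abbreviation Var :: "vname \<Rightarrow> aexp" where "Var x \<equiv> Read x (Const 0)"
abbreviation LSet :: "vname \<Rightarrow> aexp \<Rightarrow> lcom" where "LSet x \<equiv> LWrite x (Const 0)"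
abbreviation LIf :: "bexp \<Rightarrow> lcom \<Rightarrow> lcom" where "LIf b c \<equiv> LCond b c LSkip"

text \<open>The last update in the case of \<open>LFor\<close> reflects that the compiled loop leaves the value of the
  bound in its counter.\<close>

primrec sem :: "lcom \<Rightarrow> state \<Rightarrow> state" where
  "sem LSkip = (\<lambda>s. s)"
| "sem (LWrite x i a) = (\<lambda>s. upd s x (aval i s) (aval a s))"
| "sem (LSeq c1 c2) = (\<lambda>s. sem c2 (sem c1 s))"
| "sem (LCond b c1 c2) = (\<lambda>s. if bval b s then sem c1 s else sem c2 s)"
| "sem (LFor v b c) =
     (\<lambda>s. upd (fold (\<lambda>i s'. sem c (upd s' v 0 i)) [0..<s b 0] s) v 0 (s b 0))"

primrec compile :: "lcom \<Rightarrow> com" where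
  "compile LSkip = Skip"
| "compile (LWrite x i a) = Write x i a"
| "compile (LSeq c1 c2) = Seq (compile c1) (compile c2)"
| "compile (LCond b c1 c2) = Cond b (compile c1) (compile c2)"
| "compile (LFor v b c) = Seq (Write v (Const 0) (Const 0))
     (While (Less (Var v) (Var b)) (Seq (compile c) (Write v (Const 0) (Plus (Var v) (Const 1)))))"

primrec writes :: "lcom \<Rightarrow> vname set" where
  "writes LSkip = {}"
| "writes (LWrite x i a) = {x}"
| "writes (LSeq c1 c2) = writes c1 \<union> writes c2"
| "writes (LCond b c1 c2) = writes c1 \<union> writes c2"
| "writes (LFor v b c) = insert v (writes c)"

primrec bounds :: "lcom \<Rightarrow> vname set" where
  "bounds LSkip = {}"
| "bounds (LWrite x i a) = {}"
| "bounds (LSeq c1 c2) = bounds c1 \<union> bounds c2"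
| "bounds (LCond b c1 c2) = bounds c1 \<union> bounds c2"
| "bounds (LFor v b c) = insert b (bounds c)"

text \<open>\<open>compile\<close> produces while loops, which are sure to agree with
  \<open>sem\<close> when no body changes its own counter. That no bound is ever written is demanded
  separately, through \<open>writes\<close> and \<open>bounds\<close>.\<close>

primrec counters_ok :: "lcom \<Rightarrow> bool" where
  "counters_ok LSkip \<longleftrightarrow> True"
| "counters_ok (LWrite x i a) \<longleftrightarrow> True"
| "counters_ok (LSeq c1 c2) \<longleftrightarrow> counters_ok c1 \<and> counters_ok c2"
| "counters_ok (LCond b c1 c2) \<longleftrightarrow> counters_ok c1 \<and> counters_ok c2"
| "counters_ok (LFor v b c) \<longleftrightarrow> v \<notin> writes c \<and> counters_ok c"

text \<open>\<open>N\<close> bounds all loop bounds. Besides the body, a round costs 6 for the test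
  and 6 for the increment; the initialization (3) and the failing last test (6) give the 9. Adding
  up both branches of \<open>LCond\<close> keeps the cost a polynomial in \<open>N\<close>.\<close>

primrec cost :: "lcom \<Rightarrow> nat \<Rightarrow> nat" where
  "cost LSkip N = 1"
| "cost (LWrite x i a) N = 1 + acost i + acost a"
| "cost (LSeq c1 c2) N = cost c1 N + cost c2 N"
| "cost (LCond b c1 c2) N = 1 + bcost b + (cost c1 N + cost c2 N)"
| "cost (LFor v b c) N = 9 + N * (cost c N + 12)"

section \<open>Compilation of bounded loops: frame property, correctness and cost\<close>

lemma sem_frame: "x \<notin> writes c \<Longrightarrow> sem c s x = s x"
proof (induction c arbitrary: s)
  case (LFor v b c)
  have "fold (\<lambda>i s'. sem c (upd s' v 0 i)) xs s x = s x" for xs s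
    using LFor by (induction xs arbitrary: s) auto
  with LFor.prems show ?case by simp
qed auto

lemma exec_Write_upd: "exec (Write x i a) s (1 + acost i + acost a) (upd s x (aval i s) (aval a s))"
  unfolding upd_def by (rule Write)

text \<open>Since no written array is a bound, all bounds keep their initial values, at most
  \<open>N\<close>, and the induction hypothesis applies in every round of a loop.\<close>

lemma exec_compile:
  assumes "counters_ok c" "writes c \<inter> bounds c = {}" "\<forall>b\<in>bounds c. s b 0 \<le> N"
  shows "\<exists>t\<le>cost c N. exec (compile c) s t (sem c s)"
  using assms
proof (induction c arbitrary: s)
  case LSkip
  show ?case using Skip[of s] by auto
next
  case (LWrite x i a)
  show ?case using exec_Write_upd[of x i a s] by auto
next
  case (LSeq c1 c2)
  have "writes c1 \<inter> bounds c1 = {}" using LSeq.prems by auto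
  with LSeq.IH(1)[of s] LSeq.prems obtain t1 where
    1: "t1 \<le> cost c1 N" "exec (compile c1) s t1 (sem c1 s)" by auto
  have "sem c1 s b = s b" if "b \<in> bounds c2" for b
    using LSeq.prems that by (intro sem_frame) auto
  then have "\<forall>b\<in>bounds c2. sem c1 s b 0 \<le> N" using LSeq.prems by auto
  moreover have "writes c2 \<inter> bounds c2 = {}" "counters_ok c2" using LSeq.prems by auto
  ultimately obtain t2 where 2: "t2 \<le> cost c2 N" "exec (compile c2) (sem c1 s) t2 (sem c2 (sem c1 s))"
    using LSeq.IH(2) by blast
  from Seq[OF 1(2) 2(2)] 1 2 show ?case by (auto intro!: exI[of _ "t1 + t2"])
next
  case (LCond b c1 c2)
  show ?case
  proof (cases "bval b s")
    case True
    have "writes c1 \<inter> bounds c1 = {}" using LCond.prems by auto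
    with LCond.IH(1)[of s] LCond.prems obtain t where
      "t \<le> cost c1 N" "exec (compile c1) s t (sem c1 s)" by auto
    with CondTrue[OF True this(2)] True show ?thesis by (auto intro!: exI[of _ "1 + bcost b + t"])
  next
    case False
    have "writes c2 \<inter> bounds c2 = {}" using LCond.prems by auto
    with LCond.IH(2)[of s] LCond.prems obtain t where
      "t \<le> cost c2 N" "exec (compile c2) s t (sem c2 s)" by auto
    with CondFalse[OF False this(2)] False show ?thesis
      by (auto intro!: exI[of _ "1 + bcost b + t"])
  qed
next
  case (LFor v b c)
  have wb: "writes c \<inter> bounds c = {}" "b \<notin> writes c" "v \<noteq> b" "v \<notin> writes c" "v \<notin> bounds c"
    using LFor.prems by auto
  define s0 where "s0 = upd s v 0 0"
  let ?lp = "While (Less (Var v) (Var b))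
    (Seq (compile c) (Write v (Const 0) (Plus (Var v) (Const 1))))"
  have "\<exists>t\<le>cost c N. exec (compile c) s' t (sem c s')" if "\<forall>x\<in>bounds c. s' x 0 \<le> N" for s'
    using LFor.IH LFor.prems wb that by auto
  \<comment> \<open>Generalized to an arbitrary starting value \<open>i\<close> of the counter, by
    induction on the number of remaining rounds. The summand 6 is the failing last test.\<close>
  have main: "\<exists>t\<le>(s b 0 - i) * (cost c N + 12) + 6. exec ?lp (upd s' v 0 i) t
      (upd (fold (\<lambda>i s'. sem c (upd s' v 0 i)) [i..<s b 0] s') v 0 (s b 0))"
    if "i \<le> s b 0" "\<forall>x\<in>insert b (bounds c). s' x = s x" for i s'
    using that
  proof (induction "s b 0 - i" arbitrary: i s')
    case 0
    then have "i = s b 0" by simp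
    moreover have "\<not> bval (Less (Var v) (Var b)) (upd s' v 0 (s b 0))"
      using 0 wb by simp
    from WhileFalse[OF this] show ?case using \<open>i = s b 0\<close> by (intro exI[of _ 6]) (simp add: eval_nat_numeral)
  next
    case (Suc k)
    let ?W = "Write v (Const 0) (Plus (Var v) (Const 1))"
    let ?s = "upd s' v 0 i" and ?s' = "sem c (upd s' v 0 i)"
    have i: "i < s b 0" using Suc.hyps(2) by simp
    have "\<forall>x\<in>bounds c. ?s x = s x" using Suc.prems wb by (metis insertCI upd_other)
    then obtain t1 where t1: "t1 \<le> cost c N" "exec (compile c) ?s t1 ?s'"
      using LFor.IH[of ?s] LFor.prems wb by auto
    have v: "?s' v 0 = i" using wb sem_frame[of v c] by simp
    have "exec ?W ?s' (1 + acost (Const 0) + acost (Plus (Var v) (Const 1))) (upd ?s' v 0 (Suc i))"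
      using exec_Write_upd[of v "Const 0" "Plus (Var v) (Const 1)" ?s'] v by simp
    then have "exec ?W ?s' 6 (upd ?s' v 0 (Suc i))" by (simp add: eval_nat_numeral)
    from Seq[OF t1(2) this]
    have 1: "exec (Seq (compile c) ?W) ?s (t1 + 6) (upd ?s' v 0 (Suc i))" .
    have "x \<notin> writes c \<and> x \<noteq> v" if "x \<in> insert b (bounds c)" for x using that wb by auto
    then have "\<forall>x\<in>insert b (bounds c). ?s' x = s x" using Suc.prems by (simp add: sem_frame)
    moreover have "k = s b 0 - Suc i" "Suc i \<le> s b 0" using Suc.hyps(2) by auto
    ultimately obtain t2 where
      t2: "t2 \<le> (s b 0 - Suc i) * (cost c N + 12) + 6"
      "exec ?lp (upd ?s' v 0 (Suc i)) t2
        (upd (fold (\<lambda>i s'. sem c (upd s' v 0 i)) [Suc i..<s b 0] ?s') v 0 (s b 0))"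
      using Suc.hyps(1)[of "Suc i" ?s'] by blast
    have bv: "bval (Less (Var v) (Var b)) ?s" using i Suc.prems wb by simp
    have eq: "[i..<s b 0] = i # [Suc i..<s b 0]" using i by (simp add: upt_conv_Cons)
    have "exec ?lp ?s (1 + bcost (Less (Var v) (Var b)) + (t1 + 6) + t2)
        (upd (fold (\<lambda>i s'. sem c (upd s' v 0 i)) [i..<s b 0] s') v 0 (s b 0))"
      using WhileTrue[OF bv 1 t2(2)] by (simp add: eq add_ac)
    moreover have "s b 0 - i = Suc (s b 0 - Suc i)" using i by simp
    then have "1 + bcost (Less (Var v) (Var b)) + (t1 + 6) + t2 \<le> (s b 0 - i) * (cost c N + 12) + 6"
      using t1 t2 by simp
    ultimately show ?case by blast
  qed
  from main[of 0 s] obtain t where t: "t \<le> s b 0 * (cost c N + 12) + 6"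
    "exec ?lp (upd s v 0 0) t (sem (LFor v b c) s)" by auto
  have "exec (Write v (Const 0) (Const 0)) s 3 (upd s v 0 0)"
    using exec_Write_upd[of v "Const 0" "Const 0" s] by (simp add: numeral_3_eq_3)
  from Seq[OF this t(2)] have "exec (compile (LFor v b c)) s (3 + t) (sem (LFor v b c) s)" by simp
  moreover have "s b 0 \<le> N" using LFor.prems by simp
  then have "s b 0 * (cost c N + 12) \<le> N * (cost c N + 12)" by (rule mult_le_mono1)
  with t(1) have "3 + t \<le> cost (LFor v b c) N" unfolding cost.simps by linarith
  ultimately show ?case by blast
qed

lemma cost_poly: "\<exists>q. \<forall>N. cost c N = poly q N"
proof (induction c)
  case LSkip
  show ?case by (rule exI[of _ "[:1:]"]) simp
next
  case (LWrite x i a)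
  show ?case by (rule exI[of _ "[:1 + acost i + acost a:]"]) simp
next
  case (LSeq c1 c2)
  then obtain q1 q2 where "\<forall>N. cost c1 N = poly q1 N" "\<forall>N. cost c2 N = poly q2 N" by blast
  then show ?case by (intro exI[of _ "q1 + q2"]) simp
next
  case (LCond b c1 c2)
  then obtain q1 q2 where "\<forall>N. cost c1 N = poly q1 N" "\<forall>N. cost c2 N = poly q2 N" by blast
  then show ?case by (intro exI[of _ "[:1 + bcost b:] + (q1 + q2)"]) simp
next
  case (LFor v b c)
  then obtain q where "\<forall>N. cost c N = poly q N" by blast
  then show ?case by (intro exI[of _ "[:9:] + [:0, 1:] * (q + [:12:])"]) simp
qed

lemma poly_nat_mono: "x \<le> y \<Longrightarrow> poly (q :: nat poly) x \<le> poly q y"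
  by (induction q) (auto intro: add_mono mult_mono)

text \<open>Invariant rule for loops. \<open>I i\<close> describes the state before the counter is
  set to \<open>i\<close>; setting the counter, in each round and on exit, stays outside the
  invariant.\<close>

lemma sem_for:
  assumes "I 0 s" "\<And>i s'. i < s b 0 \<Longrightarrow> I i s' \<Longrightarrow> I (Suc i) (sem c (upd s' v 0 i))"
  obtains s' where "I (s b 0) s'" "sem (LFor v b c) s = upd s' v 0 (s b 0)"
proof -
  have "I k (fold (\<lambda>i s'. sem c (upd s' v 0 i)) [0..<k] s)" if "k \<le> s b 0" for k
    using that by (induction k) (auto intro: assms)
  from this[of "s b 0"] that show thesis by simp
qed

primrec areads :: "aexp \<Rightarrow> vname set" where
  "areads (Const k) = {}"
| "areads (Read x i) = insert x (areads i)"
| "areads (Plus a b) = areads a \<union> areads b"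
| "areads (Minus a b) = areads a \<union> areads b"

primrec breads :: "bexp \<Rightarrow> vname set" where
  "breads (Less a b) = areads a \<union> areads b"
| "breads (Neg b) = breads b"
| "breads (Conj a b) = breads a \<union> breads b"

lemma aval_upd: "x \<notin> areads a \<Longrightarrow> aval a (upd s x i k) = aval a s"
  by (induction a) auto

lemma bval_upd: "x \<notin> breads b \<Longrightarrow> bval b (upd s x i k) = bval b s"
  by (induction b) (auto simp: aval_upd)

text \<open>The idiom that replaces the missing arithmetic: with summand 1 it counts, with guard
  \<open>j < g\<close> it multiplies the summand by \<open>g\<close>, and with guard
  \<open>2 * j + 1 < h\<close> it halves \<open>h\<close>.\<close>

definition LSum :: "vname \<Rightarrow> vname \<Rightarrow> vname \<Rightarrow> bexp \<Rightarrow> aexp \<Rightarrow> lcom" where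
  "LSum x v b c e = LSet x (Const 0);; LFor v b (LIf c (LSet x (Plus (Var x) e)))"

lemma sem_LSum:
  assumes "x \<notin> breads c" "x \<notin> areads e" "x \<noteq> v" "b \<noteq> x"
  shows "sem (LSum x v b c e) s = upd (upd s x 0
    (\<Sum>i<s b 0. if bval c (upd s v 0 i) then aval e (upd s v 0 i) else 0)) v 0 (s b 0)"
proof -
  define f where "f i = (if bval c (upd s v 0 i) then aval e (upd s v 0 i) else 0)" for i
  \<comment> \<open>The counter is left at some \<open>k\<close> that the next round overwrites, so
    its value is existentially quantified.\<close>
  define I where "I i s' \<longleftrightarrow> (\<exists>k. s' = upd (upd s v 0 k) x 0 (\<Sum>j<i. f j))" for i s'
  let ?s = "upd s x 0 0"
  have "upd s v 0 (s v 0) = s" by (simp add: upd_def)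
  then have "I 0 ?s" unfolding I_def by (intro exI[of _ "s v 0"]) simp
  moreover have "I (Suc i) (sem (LIf c (LSet x (Plus (Var x) e))) (upd s' v 0 i))"
    if "I i s'" for i s'
  proof -
    from that obtain k where "s' = upd (upd s v 0 k) x 0 (\<Sum>j<i. f j)" unfolding I_def by blast
    then have s': "upd s' v 0 i = upd (upd s v 0 i) x 0 (\<Sum>j<i. f j)"
      using assms by (simp add: upd_swap[of x v])
    show ?thesis unfolding I_def
      by (rule exI[of _ i]) (use assms in \<open>simp add: s' f_def aval_upd bval_upd\<close>)
  qed
  ultimately obtain s' where "I (?s b 0) s'"
    "sem (LFor v b (LIf c (LSet x (Plus (Var x) e)))) ?s = upd s' v 0 (?s b 0)"
    by (rule sem_for[of I ?s b])
  then have s': "I (s b 0) s'"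
    "sem (LFor v b (LIf c (LSet x (Plus (Var x) e)))) ?s = upd s' v 0 (s b 0)"
    using assms(4) by (simp_all del: sem.simps)
  then obtain k where "s' = upd (upd s v 0 k) x 0 (\<Sum>j<s b 0. f j)" unfolding I_def by blast
  then show ?thesis using s'(2) assms(3) by (simp add: LSum_def f_def upd_swap[of x v] del: sem.simps(4,5))
qed

lemma writes_LSum [simp]: "writes (LSum x v b c e) = {x, v}"
  and bounds_LSum [simp]: "bounds (LSum x v b c e) = {b}"
  and counters_ok_LSum [simp]: "counters_ok (LSum x v b c e) \<longleftrightarrow> v \<noteq> x"
  by (auto simp: LSum_def)

section \<open>Greedy approximation for weighted MDD(max)\<close>

locale mdd =
  fixes n :: nat and E :: "nat set set" and p :: nat and w :: "nat \<Rightarrow> nat"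
  assumes inst: "mdd_instance {..<n} E p w"
begin

section \<open>Feasibility as strict degree inequalities\<close>

lemma p_less: "p < n" and w_pos: "v < n \<Longrightarrow> 0 < w v"
  and graph: "simple_graph {..<n} E"
  using inst by (auto simp: mdd_instance_def)

lemma nbrs_subset: "nbrs E u \<subseteq> {..<n} - {u}"
proof
  fix v assume "v \<in> nbrs E u"
  then have "{v, u} \<in> E" by (simp add: nbrs_def)
  then have "{v, u} \<subseteq> {..<n}" "card {v, u} = 2" using graph by (auto simp: simple_graph_def)
  then show "v \<in> {..<n} - {u}" by (cases "v = u") auto
qed

lemma finite_nbrs' [simp]: "finite (nbrs E u)"
  using finite_nbrs[OF graph] .

lemma not_self_nbr [simp]: "u \<notin> nbrs E u"
  using nbrs_subset by blast

lemma deg_induced: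
  assumes "u \<in> {..<n} - S"
  shows "deg (induced_edges E ({..<n} - S)) u = card (nbrs E u - S)"
proof -
  have "nbrs (induced_edges E ({..<n} - S)) u = nbrs E u - S"
    using assms nbrs_subset[of u] by (auto simp: nbrs_def induced_edges_def)
  then show ?thesis by (simp add: deg_def)
qed

lemma feasible_iff:
  "feasible {..<n} E p S \<longleftrightarrow> S \<subseteq> {..<n} - {p} \<and>
     (\<forall>u\<in>{..<n} - {p} - S. card (nbrs E u - S) < card (nbrs E p - S))"
proof (cases "S \<subseteq> {..<n} - {p}")
  case True
  then have p: "p \<in> {..<n} - S" using p_less by auto
  let ?d = "deg (induced_edges E ({..<n} - S))"
  have "max_degree_vertices ({..<n} - S) (induced_edges E ({..<n} - S)) = {p} \<longleftrightarrow>
      (\<forall>u\<in>{..<n} - {p} - S. ?d u < ?d p)" (is "?M = _ \<longleftrightarrow> ?R")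
  proof
    assume M: "?M = {p}"
    show ?R
    proof
      fix u assume u: "u \<in> {..<n} - {p} - S"
      have max: "?d v \<le> ?d p" if "v \<in> {..<n} - S" for v
        using M that by (auto simp: max_degree_vertices_def)
      have "u \<notin> ?M" using u M by simp
      \<comment> \<open>Not being a maximum, \<open>u\<close> is beaten by some \<open>v\<close>,
        which in turn does not beat \<open>p\<close>.\<close>
      then obtain v where "v \<in> {..<n} - S" "?d u < ?d v"
        using u by (auto simp: max_degree_vertices_def not_le)
      with max[of v] show "?d u < ?d p" by simp
    qed
  next
    assume R: ?R
    have "u = p" if "u \<in> ?M" for u
    proof (rule ccontr)
      assume "u \<noteq> p"
      with that R have "?d u < ?d p" by (auto simp: max_degree_vertices_def)
      with that p show False by (force simp: max_degree_vertices_def)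
    qed
    moreover have "?d u \<le> ?d p" if "u \<in> {..<n} - S" for u
      using R that by (cases "u = p") (auto intro: less_imp_le)
    then have "p \<in> ?M" using p by (auto simp: max_degree_vertices_def)
    ultimately show "?M = {p}" by blast
  qed
  moreover have "?R \<longleftrightarrow> (\<forall>u\<in>{..<n} - {p} - S. card (nbrs E u - S) < card (nbrs E p - S))"
    using p by (intro ball_cong) (auto simp: deg_induced)
  ultimately show ?thesis using True by (simp add: feasible_def)
qed (simp add: feasible_def)

text \<open>Putting a set of deleted neighbours of \<open>p\<close> back raises the degree of \<open>p\<close> by its size and no
  other degree by more; the vertices put back have small degree because the procedure stopped at
  \<open>L\<close>.\<close>

lemma feasible_restrict:
  assumes "feasible {..<n} E p S" "\<not> (\<exists>u. can_add E p L u)" "L \<subseteq> nbrs E p"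
  shows "feasible {..<n} E p (S - (nbrs E p - L))"
proof -
  let ?S = "S - (nbrs E p - L)"
  have S: "S \<subseteq> {..<n} - {p}" using assms by (simp add: feasible_iff)
  have fS: "finite S" "finite L" using S assms(3) by (auto intro: finite_subset)
  have less: "card (nbrs E u - L) < card (nbrs E p - L)" if "u \<in> nbrs E p - L" for u
    using assms(2) that by (force simp: can_add_def)
  have "card (nbrs E u - ?S) < card (nbrs E p - ?S)" if u: "u \<in> {..<n} - {p} - ?S" for u
  proof (cases "u \<in> S")
    case False
    let ?Y = "S \<inter> (nbrs E p - L)"
    have "card (nbrs E u - ?S) \<le> card ((nbrs E u - S) \<union> ?Y)"
      using fS by (intro card_mono) auto
    also have "\<dots> \<le> card (nbrs E u - S) + card ?Y" by (rule card_Un_le)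
    also have "\<dots> < card (nbrs E p - S) + card ?Y"
      using False u assms(1) by (auto simp: feasible_iff)
    also have "\<dots> = card ((nbrs E p - S) \<union> ?Y)"
      using fS by (intro card_Un_disjoint[symmetric]) auto
    also have "(nbrs E p - S) \<union> ?Y = nbrs E p - ?S" by auto
    finally show ?thesis .
  next
    case True
    then have uL: "u \<in> nbrs E p - L" using u by auto
    have "card (nbrs E u - ?S) \<le> card ((nbrs E u - L) \<union> (L - S))"
      using fS by (intro card_mono) auto
    also have "\<dots> \<le> card (nbrs E u - L) + card (L - S)" by (rule card_Un_le)
    also have "\<dots> < card (nbrs E p - L) + card (L - S)" using less[OF uL] by simp
    also have "\<dots> = card ((nbrs E p - L) \<union> (L - S))"
      using fS by (intro card_Un_disjoint[symmetric]) auto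
    also have "(nbrs E p - L) \<union> (L - S) = nbrs E p - ?S" using assms(3) by auto
    finally show ?thesis .
  qed
  then show ?thesis using S by (auto simp: feasible_iff)
qed

text \<open>The total unmet demand; truncated subtraction makes satisfied vertices contribute 0.
  Surviving neighbours of \<open>p\<close> are counted as well: their degrees must drop although the
  greedy algorithm does not delete them.\<close>

definition phi :: "nat \<Rightarrow> nat set \<Rightarrow> nat" where
  "phi d S = (\<Sum>u<n. if u \<notin> S \<and> u \<noteq> p then Suc (card (nbrs E u - S)) - d else 0)"

lemma phi_eq_0_iff: "phi d S = 0 \<longleftrightarrow> (\<forall>u\<in>{..<n} - {p} - S. card (nbrs E u - S) < d)"
  by (auto simp: phi_def Suc_le_eq)

text \<open>A degree is at most \<open>n - 1\<close>, so no demand exceeds \<open>n\<close>. The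
  bound limits both the number of greedy rounds and the logarithm in the approximation
  factor.\<close>

lemma phi_le: "phi d S \<le> n * n"
proof -
  have "Suc (card (nbrs E u - S)) - d \<le> n" if "u < n" for u
  proof -
    have "card (nbrs E u - S) \<le> card ({..<n} - {u})"
      using nbrs_subset[of u] by (intro card_mono) auto
    then show ?thesis using that by (simp add: card_Diff_singleton)
  qed
  then have "phi d S \<le> (\<Sum>u<n. n)" unfolding phi_def by (intro sum_mono) auto
  then show ?thesis by simp
qed

definition gain :: "nat \<Rightarrow> nat set \<Rightarrow> nat \<Rightarrow> nat" where
  "gain d S x = phi d S - phi d (insert x S)"

lemma phi_mono: "S \<subseteq> S' \<Longrightarrow> phi d S' \<le> phi d S"
  unfolding phi_def by (rule sum_mono) (auto intro!: diff_le_mono card_mono)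

text \<open>The argument goes vertex by vertex. The demand of a \<open>u\<close> in \<open>X\<close>
  disappears once \<open>u\<close> itself is deleted. Any other \<open>u\<close> has at least as
  many neighbours in \<open>X\<close> as its demand, and each of them alone lowers a positive demand
  by one.\<close>

lemma phi_le_sum_gain:
  assumes X: "finite X" and 0: "phi d (S \<union> X) = 0"
  shows "phi d S \<le> (\<Sum>x\<in>X. gain d S x)"
proof -
  define f where "f T u = (if u \<notin> T \<and> u \<noteq> p then Suc (card (nbrs E u - T)) - d else 0)" for T u
  have phi_f: "phi d T = (\<Sum>u<n. f T u)" for T by (simp add: phi_def f_def)
  have mono: "f (insert x S) u \<le> f S u" for x u
    unfolding f_def by (auto intro!: diff_le_mono card_mono)
  have g: "gain d S x = (\<Sum>u<n. f S u - f (insert x S) u)" for x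
    unfolding gain_def phi_f by (rule sum_subtractf_nat[symmetric]) (simp add: mono)
  have "f S u \<le> (\<Sum>x\<in>X. f S u - f (insert x S) u)" if "u < n" for u
  proof (cases "u \<notin> S \<and> u \<noteq> p")
    case False
    then have "f S u = 0" by (auto simp: f_def)
    then show ?thesis by simp
  next
    case u: True
    show ?thesis
    proof (cases "u \<in> X")
      case True
      have "f S u = f S u - f (insert u S) u" by (simp add: f_def)
      also have "\<dots> \<le> (\<Sum>x\<in>X. f S u - f (insert x S) u)"
        using True X by (intro member_le_sum) auto
      finally show ?thesis .
    next
      case False
      have small: "card (nbrs E u - S - X) < d"
      proof -
        have "nbrs E u - S - X = nbrs E u - (S \<union> X)" by auto
        then show ?thesis using 0 u False that by (auto simp: phi_eq_0_iff)
      qed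
      let ?Y = "X \<inter> (nbrs E u - S)"
      have "card (nbrs E u - S) = card ((nbrs E u - S - X) \<union> ?Y)"
        by (rule arg_cong[where f = card]) auto
      also have "\<dots> = card (nbrs E u - S - X) + card ?Y"
        using X by (intro card_Un_disjoint) auto
      finally have "f S u \<le> card ?Y" using small by (auto simp: f_def)
      also have "\<dots> = (\<Sum>x\<in>?Y. 1)" by simp
      \<comment> \<open>Positivity of the demand matters here, because truncated subtraction hides a
        drop below 0.\<close>
      also have "\<dots> \<le> (\<Sum>x\<in>?Y. f S u - f (insert x S) u)" if "f S u \<noteq> 0"
      proof (rule sum_mono)
        fix x assume x: "x \<in> ?Y"
        have "nbrs E u - insert x S = (nbrs E u - S) - {x}" by auto
        then have "card (nbrs E u - S) = Suc (card (nbrs E u - insert x S))"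
          using x card.remove[of "nbrs E u - S" x] by simp
        moreover have "x \<noteq> u" using x by auto
        ultimately show "1 \<le> f S u - f (insert x S) u"
          using u that by (auto simp: f_def)
      qed
      also have "\<dots> \<le> (\<Sum>x\<in>X. f S u - f (insert x S) u)"
        using X by (intro sum_mono2) auto
      finally show ?thesis by (cases "f S u = 0") auto
    qed
  qed
  then have "phi d S \<le> (\<Sum>u<n. \<Sum>x\<in>X. f S u - f (insert x S) u)"
    unfolding phi_f by (intro sum_mono) auto
  also have "\<dots> = (\<Sum>x\<in>X. gain d S x)" unfolding g by (rule sum.swap)
  finally show ?thesis .
qed

section \<open>The weighted greedy rule and its amortized cost\<close>

abbreviation U :: "nat set" where "U \<equiv> {..<n} - {p} - nbrs E p"

text \<open>Best gain per weight, with fractions cross-multiplied as on the machine. Being a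
  relation, it leaves open how ties are broken.\<close>

definition greedy_choice :: "nat \<Rightarrow> nat set \<Rightarrow> nat set \<Rightarrow> bool" where
  "greedy_choice d S S' \<longleftrightarrow> (S' = S \<and> (\<forall>x\<in>U. gain d S x = 0)) \<or>
     (\<exists>b\<in>U. S' = insert b S \<and> 0 < gain d S b \<and>
        (\<forall>x\<in>U. gain d S x * w b \<le> gain d S b * w x))"

text \<open>The price still to be paid per unit of optimal weight when the potential is \<open>k\<close>.\<close>

definition h :: "nat \<Rightarrow> real" where
  "h k = (if k = 0 then 0 else 1 + ln (real k))"

text \<open>For \<open>g < k\<close> this is \<open>ln x \<le> x - 1\<close> at
  \<open>x = (k - g) / k\<close>; for \<open>g = k\<close> the left side is 1, which the jump of
  \<open>h\<close> at 0 pays for.\<close>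

lemma h_diff:
  assumes "g \<le> k" "0 < k"
  shows "real g / real k \<le> h k - h (k - g)"
proof (cases "g = k")
  case True
  then show ?thesis using assms by (simp add: h_def)
next
  case False
  then have k: "real (k - g) > 0" "real k > 0" using assms by auto
  have "ln (real (k - g) / real k) \<le> real (k - g) / real k - 1"
    using k by (intro ln_le_minus_one) simp
  then have "real g / real k \<le> ln (real k) - ln (real (k - g))"
    using k assms by (simp add: ln_div of_nat_diff field_simps)
  then show ?thesis using k by (simp add: h_def)
qed

text \<open>Amortized bound: the weight spent plus the price of the remaining potential stays below
  the initial total, for every completion \<open>X\<close> of \<open>T\<close> at once. If
  \<open>T\<close> has a completion, each round also removes a unit of potential until none is
  left.\<close>

definition greedy_inv :: "nat \<Rightarrow> nat set \<Rightarrow> nat \<Rightarrow> nat set \<Rightarrow> bool" where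
  "greedy_inv d T i S \<longleftrightarrow> T \<subseteq> S \<and> S \<subseteq> T \<union> U \<and> (\<forall>X\<subseteq>U. phi d (T \<union> X) = 0 \<longrightarrow>
     real (sum w S) + real (sum w X) * h (phi d S) \<le> real (sum w T) + real (sum w X) * h (phi d T) \<and>
     phi d S \<le> phi d T - i)"

lemma greedy_inv_0: "greedy_inv d T 0 T"
  by (simp add: greedy_inv_def)

text \<open>The greedy choice is at least as good as the average over \<open>X\<close>, whose gains
  cover the whole potential. So \<open>w b\<close> is at most the weight of \<open>X\<close> times
  the fraction of the potential that is removed, and by \<open>h_diff\<close> the drop of
  \<open>h\<close> pays for it.\<close>

lemma greedy_inv_Suc:
  assumes inv: "greedy_inv d T i S" and step: "greedy_choice d S S'" and T: "finite T"
  shows "greedy_inv d T (Suc i) S'"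
proof -
  have S: "T \<subseteq> S" "S \<subseteq> T \<union> U" using inv by (auto simp: greedy_inv_def)
  have fS: "finite S" by (rule finite_subset[OF S(2)]) (use T in auto)
  have sub: "T \<subseteq> S' \<and> S' \<subseteq> T \<union> U" using step S by (auto simp: greedy_choice_def)
  have "real (sum w S') + real (sum w X) * h (phi d S') \<le> real (sum w T) + real (sum w X) * h (phi d T) \<and>
     phi d S' \<le> phi d T - Suc i"
    if X: "X \<subseteq> U" and 0: "phi d (T \<union> X) = 0" for X
  proof -
    have fX: "finite X" by (rule finite_subset[OF X]) auto
    have old: "real (sum w S) + real (sum w X) * h (phi d S) \<le> real (sum w T) + real (sum w X) * h (phi d T)"
      "phi d S \<le> phi d T - i"
      using inv X 0 by (auto simp: greedy_inv_def)
    have "phi d (S \<union> X) \<le> phi d (T \<union> X)" using S by (intro phi_mono) auto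
    then have "phi d (S \<union> X) = 0" using 0 by simp
    note cover = phi_le_sum_gain[OF fX this]
    from step consider "S' = S" "\<forall>x\<in>U. gain d S x = 0"
      | b where "b \<in> U" "S' = insert b S" "0 < gain d S b"
        "\<And>x. x \<in> U \<Longrightarrow> gain d S x * w b \<le> gain d S b * w x"
      by (auto simp: greedy_choice_def)
    then show ?thesis
    proof cases
      case 1
      \<comment> \<open>Since adding \<open>X\<close> would meet all demands, the absence of any
        gain means that no demand is left.\<close>
      then have "(\<Sum>x\<in>X. gain d S x) = 0" using X by (intro sum.neutral) auto
      then have "phi d S = 0" using cover by simp
      then show ?thesis using old 1 by simp
    next
      case 2
      let ?g = "gain d S b" and ?k = "phi d S" and ?W = "sum w X"
      have phi': "phi d S' = ?k - ?g"
        using phi_mono[of S S' d] 2 by (auto simp: gain_def)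
      have g: "?g \<le> ?k" "0 < ?k" using 2(3) by (auto simp: gain_def)
      have "b \<notin> S" using 2(3) by (auto simp: gain_def insert_absorb)
      then have wS: "sum w S' = w b + sum w S" using 2 fS by simp
      \<comment> \<open>Averaging: the greedy comparison of \<open>b\<close> with \<open>x\<close>
        is summed over all \<open>x\<close> in \<open>X\<close>.\<close>
      have "?k * w b \<le> (\<Sum>x\<in>X. gain d S x) * w b" using cover by (rule mult_le_mono1)
      also have "\<dots> = (\<Sum>x\<in>X. gain d S x * w b)" by (rule sum_distrib_right)
      also have "\<dots> \<le> (\<Sum>x\<in>X. ?g * w x)" using 2(4) X by (intro sum_mono) auto
      also have "\<dots> = ?g * ?W" by (rule sum_distrib_left[symmetric])
      finally have "real (?k * w b) \<le> real (?g * ?W)" by (simp only: of_nat_le_iff)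
      then have "real (w b) \<le> real ?W * (real ?g / real ?k)"
        using g by (simp add: field_simps)
      also have "\<dots> \<le> real ?W * (h ?k - h (?k - ?g))"
        by (intro mult_left_mono h_diff g) (simp del: of_nat_sum)
      finally have "real (w b) + real ?W * h (?k - ?g) \<le> real ?W * h ?k"
        by (simp add: algebra_simps)
      then show ?thesis using old 2(3) by (simp add: phi' wS)
    qed
  qed
  with sub show ?thesis by (simp add: greedy_inv_def)
qed

text \<open>The potential starts at no more than \<open>n * n\<close>, so this many rounds exhaust
  it.\<close>

lemma greedy_inv_final:
  assumes inv: "greedy_inv d T (n ^ Suc (Suc k)) S" and X: "X \<subseteq> U" and 0: "phi d (T \<union> X) = 0"
  shows "phi d S = 0" "real (sum w S) \<le> real (sum w T) + real (sum w X) * h (phi d T)"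
proof -
  have "phi d T \<le> n ^ Suc (Suc k)"
  proof (rule order_trans[OF phi_le])
    have "n * n * 1 \<le> n * n * n ^ k" using p_less by (intro mult_le_mono2) simp
    then show "n * n \<le> n ^ Suc (Suc k)" by (simp add: mult.assoc)
  qed
  moreover have *: "real (sum w S) + real (sum w X) * h (phi d S) \<le> real (sum w T) + real (sum w X) * h (phi d T)"
    "phi d S \<le> phi d T - n ^ Suc (Suc k)"
    using assms by (auto simp: greedy_inv_def)
  ultimately show 1: "phi d S = 0" by simp
  then show "real (sum w S) \<le> real (sum w T) + real (sum w X) * h (phi d T)"
    using * by (simp add: h_def)
qed

text \<open>As the potential is at most \<open>n * n\<close>, a nonzero price is at most
  \<open>1 + 2 * ln n\<close>; both 1 and \<open>ln n\<close> are at most \<open>log 2 n\<close> for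
  these \<open>n\<close>.\<close>

lemma h_phi_le:
  assumes "2 \<le> n"
  shows "h (phi d T) \<le> 3 * log 2 (real n)"
proof -
  have l: "1 \<le> log 2 (real n)" using assms by (simp add: le_log_iff)
  have "ln (2 :: real) \<le> 1" using ln_le_minus_one[of "2 :: real"] by simp
  then have lnlog: "ln (real n) \<le> log 2 (real n)"
    using assms by (simp add: log_def field_simps mult_left_le)
  show ?thesis
  proof (cases "phi d T = 0")
    case True
    then show ?thesis using l by (simp add: h_def)
  next
    case False
    have "real (phi d T) \<le> real n * real n" using phi_le[of d T] by (metis of_nat_le_iff of_nat_mult)
    then have "ln (real (phi d T)) \<le> ln (real n * real n)" using False by simp
    also have "\<dots> = 2 * ln (real n)" using assms by (simp add: ln_mult)
    finally show ?thesis using False l lnlog by (simp add: h_def)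
  qed
qed

section \<open>Candidates and the guess that matches an optimal solution\<close>

definition candidate :: "nat \<Rightarrow> nat set \<Rightarrow> nat set \<Rightarrow> bool" where
  "candidate k T S \<longleftrightarrow> greedy_inv (card (nbrs E p - T)) T (n ^ Suc (Suc k)) S"

text \<open>The greedy algorithm adds only vertices of \<open>U\<close>, so the final degree of
  \<open>p\<close> is the one fixed by \<open>T\<close>.\<close>

lemma candidate_feasible_iff:
  assumes "candidate k T S" "T \<subseteq> nbrs E p"
  shows "feasible {..<n} E p S \<longleftrightarrow> phi (card (nbrs E p - T)) S = 0"
proof -
  have S: "T \<subseteq> S" "S \<subseteq> T \<union> U" using assms by (auto simp: candidate_def greedy_inv_def)
  have "S \<subseteq> {..<n} - {p}" using S assms(2) nbrs_subset[of p] by auto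
  moreover have "nbrs E p - S = nbrs E p - T" using S by auto
  ultimately show ?thesis by (simp add: feasible_iff phi_eq_0_iff)
qed

text \<open>\<open>T\<close> is the part inside \<open>N(p)\<close> of an optimal solution cut down
  by \<open>feasible_restrict\<close>; its other part \<open>X\<close> is the completion against
  which the greedy weight is measured. The case \<open>n = 1\<close>, where the logarithm vanishes,
  is settled later.\<close>

lemma exists_good_candidate:
  assumes L: "L_produced E p L"
  obtains T where "T \<subseteq> L" and "\<And>k S. candidate k T S \<Longrightarrow>
     feasible {..<n} E p S \<and> (n = 1 \<or>
     real (sum w S) \<le> 4 * log 2 (real n) * real (min_weight {..<n} E p w))"
proof -
  have L': "L \<subseteq> nbrs E p" "\<not> (\<exists>u. can_add E p L u)"
    using L by (auto simp: L_produced_def L_reachable_subset)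
  let ?M = "{sum w S | S. feasible {..<n} E p S}"
  have "?M \<subseteq> sum w ` Pow {..<n}" by (auto simp: feasible_iff)
  then have fin: "finite ?M" by (rule finite_subset) simp
  have "feasible {..<n} E p ({..<n} - {p})" by (auto simp: feasible_iff)
  then have "?M \<noteq> {}" by blast
  from Min_in[OF fin this] obtain S0 where
    S0: "feasible {..<n} E p S0" "sum w S0 = min_weight {..<n} E p w"
    by (auto simp: min_weight_def)
  define S1 where "S1 = S0 - (nbrs E p - L)"
  have S1: "feasible {..<n} E p S1" unfolding S1_def using S0 L' by (intro feasible_restrict) auto
  have fS: "finite S0" using S0 by (auto simp: feasible_iff intro: finite_subset)
  have w1: "sum w S1 \<le> min_weight {..<n} E p w"
    unfolding S0(2)[symmetric] S1_def using fS by (intro sum_mono2) auto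
  define T where "T = S1 \<inter> nbrs E p"
  define X where "X = S1 - nbrs E p"
  have TX: "T \<union> X = S1" "T \<inter> X = {}" "X \<subseteq> U" "T \<subseteq> nbrs E p"
    using S1 by (auto simp: T_def X_def feasible_iff)
  have fTX: "finite T" "finite X" using fS by (auto simp: T_def X_def S1_def)
  have wTX: "sum w T + sum w X = sum w S1" using TX fTX sum.union_disjoint[of T X w] by auto
  have "nbrs E p - S1 = nbrs E p - T" by (auto simp: T_def)
  then have 0: "phi (card (nbrs E p - T)) (T \<union> X) = 0"
    using S1 by (auto simp: phi_eq_0_iff feasible_iff TX(1))
  have "feasible {..<n} E p S \<and> (n = 1 \<or>
     real (sum w S) \<le> 4 * log 2 (real n) * real (min_weight {..<n} E p w))"
    if S: "candidate k T S" for k S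
  proof -
    note * = greedy_inv_final[OF S[unfolded candidate_def] TX(3) 0]
    have "real (sum w S) \<le> 4 * log 2 (real n) * real (min_weight {..<n} E p w)" if "n \<noteq> 1"
    proof -
      have n: "2 \<le> n" using that p_less by simp
      have l: "1 \<le> log 2 (real n)" using n by (simp add: le_log_iff)
      note *(2)
      \<comment> \<open>\<open>T\<close> is paid at rate 1 and \<open>X\<close> at rate at most
        \<open>3 * log 2 n\<close>; both are raised to a common rate so that the weights combine to
        that of \<open>S1\<close>.\<close>
      also have "real (sum w T) + real (sum w X) * h (phi (card (nbrs E p - T)) T)
          \<le> real (sum w T) * (4 * log 2 (real n)) + real (sum w X) * (4 * log 2 (real n))"
      proof (rule add_mono)
        show "real (sum w T) \<le> real (sum w T) * (4 * log 2 (real n))"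
          using l by (simp add: mult_le_cancel_left1 del: of_nat_sum)
        show "real (sum w X) * h (phi (card (nbrs E p - T)) T) \<le> real (sum w X) * (4 * log 2 (real n))"
          using l h_phi_le[OF n, of "card (nbrs E p - T)" T]
          by (intro mult_left_mono) (simp_all del: of_nat_sum)
      qed
      also have "\<dots> = 4 * log 2 (real n) * real (sum w S1)"
        by (simp add: wTX[symmetric] algebra_simps del: of_nat_sum)
      also have "\<dots> \<le> 4 * log 2 (real n) * real (min_weight {..<n} E p w)"
        using l w1 by (intro mult_left_mono) (simp_all del: of_nat_sum)
      finally show ?thesis .
    qed
    with candidate_feasible_iff[OF S TX(4)] *(1) show ?thesis by blast
  qed
  moreover have "T \<subseteq> L" by (auto simp: T_def S1_def)
  ultimately show thesis using that by blast
qed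

end

section \<open>The program\<close>

abbreviation Zero :: "aexp \<Rightarrow> bexp" where "Zero a \<equiv> Less a (Const 1)"
abbreviation NonZero :: "aexp \<Rightarrow> bexp" where "NonZero a \<equiv> Less (Const 0) a"
abbreviation NotEq :: "aexp \<Rightarrow> aexp \<Rightarrow> bexp" where
  "NotEq a b \<equiv> Neg (Conj (Neg (Less a b)) (Neg (Less b a)))"
text \<open>The array \<open>row\<close> holds the row offsets \<open>u * n\<close> of the matrix,
  computed once by repeated addition.\<close>

abbreviation Adj :: "vname \<Rightarrow> vname \<Rightarrow> aexp" where
  "Adj u v \<equiv> Read ''adj'' (Plus (Read ''row'' (Var u)) (Var v))"
abbreviation At :: "vname \<Rightarrow> vname \<Rightarrow> aexp" where "At x i \<equiv> Read x (Var i)"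

text \<open>As \<open>k\<close> is fixed with the program, the \<open>k\<close> multiplications by
  \<open>n\<close> are unrolled. The result \<open>B\<close> bounds loops of
  \<open>main_prog\<close>, and \<open>exec_compile\<close> forbids writing to bounds, so this part
  is compiled on its own.\<close>

definition pow_prog :: "nat \<Rightarrow> lcom" where
  "pow_prog k = LSet ''B'' (Const 1);;
     foldr (\<lambda>_. LSeq (LSum ''q'' ''i'' ''n'' (NonZero (Const 1)) (Var ''B'');; LSet ''B'' (Var ''q'')))
       [0..<k] LSkip"

definition row_prog :: lcom where
  "row_prog = LFor ''i'' ''n'' (LWrite ''row'' (Plus (Var ''i'') (Const 1))
     (Plus (At ''row'' ''i'') (Var ''n'')))"

definition count_prog :: "vname \<Rightarrow> vname \<Rightarrow> vname \<Rightarrow> lcom" where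
  "count_prog x u S = LSum x ''v'' ''n'' (Conj (NonZero (Adj u ''v'')) (Zero (At S ''v''))) (Const 1)"

definition L_prog :: lcom where
  "L_prog = LFor ''r'' ''n'' (LFor ''u'' ''n'' (
     count_prog ''a'' ''u'' ''L'';; count_prog ''c'' ''p'' ''L'';;
     LIf (Conj (Conj (NonZero (Adj ''p'' ''u'')) (Zero (At ''L'' ''u''))) (Neg (Less (Var ''a'') (Var ''c''))))
       (LWrite ''L'' (Var ''u'') (Const 1))))"

definition phi_prog :: lcom where
  "phi_prog = LSet ''phi'' (Const 0);; LFor ''u'' ''n'' (
     LIf (Conj (Zero (At ''S'' ''u'')) (NotEq (Var ''u'') (Var ''p'')))
       (count_prog ''k'' ''u'' ''S'';;
        LSet ''phi'' (Plus (Var ''phi'') (Minus (Plus (Var ''k'') (Const 1)) (Var ''d'')))))"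

text \<open>Compares the ratios \<open>g / w x\<close> and \<open>gb / wb\<close> through the
  products \<open>g * wb\<close> and \<open>gb * w x\<close>. Gains, not weights, control the loops:
  gains are at most \<open>B\<close>, whereas weights may be exponential in the input size.\<close>

definition compare_prog :: lcom where
  "compare_prog =
     LSum ''m1'' ''j'' ''B'' (Less (Var ''j'') (Var ''g'')) (Var ''wb'');;
     LSum ''m2'' ''j'' ''B'' (Less (Var ''j'') (Var ''gb'')) (At ''w'' ''x'');;
     LIf (Less (Var ''m2'') (Var ''m1''))
       (LSet ''gb'' (Var ''g'');; LSet ''wb'' (At ''w'' ''x'');; LSet ''b'' (Var ''x''))"

text \<open>\<open>x\<close> may already belong to \<open>S\<close>, so the old entry is saved and
  restored instead of being cleared.\<close>

definition gain_prog :: lcom where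
  "gain_prog = LSet ''t'' (At ''S'' ''x'');; LWrite ''S'' (Var ''x'') (Const 1);; phi_prog;;
     LWrite ''S'' (Var ''x'') (Var ''t'');; LSet ''g'' (Minus (Var ''F'') (Var ''phi''))"

text \<open>The best ratio \<open>gb / wb\<close> starts as 0 / 1 and is replaced only by a strictly
  better one, so \<open>gb\<close> stays 0 exactly when no gain is positive.\<close>

definition greedy_prog :: lcom where
  "greedy_prog = (phi_prog;; LSet ''F'' (Var ''phi'');; LSet ''gb'' (Const 0);;
     LSet ''wb'' (Const 1);; LSet ''b'' (Const 0));;
     LFor ''x'' ''n'' (LIf (Conj (NotEq (Var ''x'') (Var ''p'')) (Zero (Adj ''p'' ''x'')))
       (gain_prog;; compare_prog));;
     LIf (NonZero (Var ''gb'')) (LWrite ''S'' (Var ''b'') (Const 1))"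

text \<open>Reads \<open>m\<close> as a binary number, lowest digit first, one digit for each vertex
  of \<open>L\<close> in increasing order; \<open>h\<close> is the unread rest and \<open>q\<close>
  its half, rounded down.\<close>

definition decode_prog :: lcom where
  "decode_prog = LSet ''h'' (Var ''m'');; LFor ''i'' ''n'' (LWrite ''S'' (Var ''i'') (Const 0);;
     LIf (NonZero (At ''L'' ''i''))
       (LSum ''q'' ''j'' ''B'' (Less (Plus (Plus (Var ''j'') (Var ''j'')) (Const 1)) (Var ''h'')) (Const 1);;
        LWrite ''S'' (Var ''i'') (Minus (Var ''h'') (Plus (Var ''q'') (Var ''q'')));;
        LSet ''h'' (Var ''q'')))"

definition candidate_prog :: lcom where
  "candidate_prog = decode_prog;; count_prog ''d'' ''p'' ''S'';; LFor ''r'' ''B'' greedy_prog"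

definition record_prog :: lcom where
  "record_prog = phi_prog;; LSum ''cost'' ''i'' ''n'' (NonZero (At ''S'' ''i'')) (At ''w'' ''i'');;
     LIf (Conj (Zero (Var ''phi'')) (Less (Var ''cost'') (Var ''bw'')))
       (LSet ''bw'' (Var ''cost'');; LFor ''i'' ''n'' (LWrite ''out'' (Var ''i'') (At ''S'' ''i'')))"

text \<open>The best weight \<open>bw\<close> found so far starts with the weight of all vertices including \<open>p\<close>, which
  exceeds that of every feasible solution.\<close>

definition main_prog :: lcom where
  "main_prog = row_prog;; L_prog;;
     LSum ''bw'' ''i'' ''n'' (NonZero (Const 1)) (At ''w'' ''i'');;
     LFor ''m'' ''B'' (candidate_prog;; record_prog)"

lemmas prog_defs = row_prog_def count_prog_def L_prog_def phi_prog_def compare_prog_def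
  gain_prog_def greedy_prog_def decode_prog_def candidate_prog_def record_prog_def main_prog_def

lemma writes_prog [simp]:
  "writes row_prog = {''i'', ''row''}"
  "writes (count_prog x u S) = {x, ''v''}"
  "writes L_prog = {''r'', ''u'', ''a'', ''c'', ''v'', ''L''}"
  "writes phi_prog = {''phi'', ''u'', ''k'', ''v''}"
  "writes compare_prog = {''m1'', ''m2'', ''j'', ''gb'', ''wb'', ''b''}"
  "writes gain_prog = {''t'', ''S'', ''g''} \<union> writes phi_prog"
  "writes greedy_prog = {''F'', ''x''} \<union> writes gain_prog \<union> writes compare_prog"
  "writes decode_prog = {''h'', ''i'', ''S'', ''q'', ''j''}"
  "writes candidate_prog = {''d'', ''r'', ''v''} \<union> writes decode_prog \<union> writes greedy_prog"
  "writes record_prog = {''cost'', ''i'', ''bw'', ''out''} \<union> writes phi_prog"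
  "writes main_prog = {''m'', ''bw'', ''i''} \<union> writes row_prog \<union> writes L_prog \<union>
     writes candidate_prog \<union> writes record_prog"
  by (auto simp: prog_defs)

lemma main_prog_ok:
  "counters_ok main_prog" "writes main_prog \<inter> bounds main_prog = {}" "bounds main_prog = {''n'', ''B''}"
proof -
  show b: "bounds main_prog = {''n'', ''B''}" by (auto simp: prog_defs)
  show "counters_ok main_prog" by (simp add: prog_defs)
  show "writes main_prog \<inter> bounds main_prog = {}" unfolding b by simp
qed

lemma pow_prog_ok:
  "counters_ok (pow_prog k)" "writes (pow_prog k) \<subseteq> {''B'', ''q'', ''i''}" "bounds (pow_prog k) \<subseteq> {''n''}"
proof -
  let ?c = "\<lambda>xs. foldr (\<lambda>_::nat. LSeq (LSum ''q'' ''i'' ''n'' (NonZero (Const 1)) (Var ''B'');;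
    LSet ''B'' (Var ''q''))) xs LSkip"
  have "counters_ok (?c xs) \<and> writes (?c xs) \<subseteq> {''B'', ''q'', ''i''} \<and> bounds (?c xs) \<subseteq> {''n''}" for xs
    by (induction xs) auto
  then show "counters_ok (pow_prog k)" "writes (pow_prog k) \<subseteq> {''B'', ''q'', ''i''}"
    "bounds (pow_prog k) \<subseteq> {''n''}" by (auto simp: pow_prog_def)
qed

lemma sem_pow_prog: "sem (pow_prog k) s ''B'' 0 = s ''n'' 0 ^ k"
proof -
  let ?b = "LSum ''q'' ''i'' ''n'' (NonZero (Const 1)) (Var ''B'');; LSet ''B'' (Var ''q'')"
  have step: "sem ?b s ''B'' 0 = s ''n'' 0 * s ''B'' 0" "sem ?b s ''n'' = s ''n''" for s
    by (simp_all add: sem_LSum)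
  have "sem (foldr (\<lambda>_. LSeq ?b) xs LSkip) s ''B'' 0 = s ''n'' 0 ^ length xs * s ''B'' 0"
    for xs :: "nat list" and s
  proof (induction xs arbitrary: s)
    case (Cons x xs)
    have "sem (foldr (\<lambda>_. LSeq ?b) (x # xs) LSkip) s = sem (foldr (\<lambda>_. LSeq ?b) xs LSkip) (sem ?b s)"
      by simp
    then show ?case using Cons[of "sem ?b s"] step[of s] by (simp del: sem.simps)
  qed simp
  then show ?thesis by (simp add: pow_prog_def)
qed

section \<open>Correctness of the program\<close>

definition vset :: "nat \<Rightarrow> (nat \<Rightarrow> nat) \<Rightarrow> nat set" where
  "vset n a = {i. i < n \<and> a i \<noteq> 0}"

lemma vset_upd [simp]: "x < n \<Longrightarrow> k \<noteq> 0 \<Longrightarrow> vset n (a(x := k)) = insert x (vset n a)"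
  and finite_vset [simp]: "finite (vset n a)"
  by (auto simp: vset_def)

lemma sum_below_eq_mult: "g \<le> N \<Longrightarrow> (\<Sum>i<N. if i < g then c else 0) = g * (c :: nat)"
proof -
  assume "g \<le> N"
  then have "{..<N} \<inter> {i. i < g} = {..<g}" by auto
  then show ?thesis by (simp add: sum.If_cases)
qed

lemma sum_below_half: "h \<le> N \<Longrightarrow> (\<Sum>j<N. if Suc (j + j) < h then Suc 0 else 0) = h div 2"
proof -
  assume "h \<le> N"
  then have "{..<N} \<inter> {j. Suc (j + j) < h} = {..<h div 2}" by auto
  then show ?thesis by (simp add: sum.If_cases)
qed

text \<open>The last \<open>i\<close> vertices of \<open>T\<close> as a binary number with one digit for each of the last \<open>i\<close>
  vertices that are in \<open>L\<close>.\<close>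

fun enc :: "nat \<Rightarrow> nat set \<Rightarrow> nat set \<Rightarrow> nat \<Rightarrow> nat" where
  "enc n L T 0 = 0"
| "enc n L T (Suc i) = (if n - Suc i \<in> L then of_bool (n - Suc i \<in> T) + 2 * enc n L T i
     else enc n L T i)"

text \<open>One digit is spent on each element of \<open>L\<close> among the last \<open>i\<close>
  vertices. For \<open>i = n\<close> this ensures that all subsets of \<open>L\<close> are met when
  \<open>m\<close> runs up to a bound of at least \<open>2 ^ card L\<close>.\<close>

lemma enc_less: "i \<le> n \<Longrightarrow> enc n L T i < 2 ^ card (L \<inter> {n - i..<n})"
proof (induction i)
  case (Suc i)
  let ?v = "n - Suc i"
  have iv: "{?v..<n} = insert ?v {n - i..<n}" "?v \<notin> {n - i..<n}" using Suc.prems by auto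
  then have "card (L \<inter> {?v..<n}) = of_bool (?v \<in> L) + card (L \<inter> {n - i..<n})"
    by (simp add: Int_insert_right)
  with Suc show ?case by (auto simp: Suc_le_eq)
qed simp

section \<open>Each part of the program against its mathematical counterpart\<close>

context mdd
begin

text \<open>What the parts after \<open>row_prog\<close> rely on and leave unchanged. Adjacency is
  expressed through \<open>row\<close>, as these parts read it.\<close>

definition ok :: "nat \<Rightarrow> state \<Rightarrow> bool" where
  "ok k s \<longleftrightarrow> s ''n'' 0 = n \<and> s ''p'' 0 = p \<and> s ''B'' 0 = n ^ Suc (Suc k) \<and>
     (\<forall>i<n. s ''w'' i = w i) \<and>
     (\<forall>u<n. \<forall>v<n. s ''adj'' (s ''row'' u + v) = (if v \<in> nbrs E u then 1 else 0))"

lemma ok_upd [simp]: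
  assumes "x \<notin> {''n'', ''p'', ''B'', ''w'', ''adj'', ''row''}"
  shows "ok k (upd s x i a) = ok k s"
proof -
  have "upd s x i a y = s y" if "y \<in> {''n'', ''p'', ''B'', ''w'', ''adj'', ''row''}" for y
    using assms that by (intro upd_other) blast
  then show ?thesis by (simp add: ok_def)
qed

lemma ok_sem:
  assumes "ok k s" "writes c \<inter> {''n'', ''p'', ''B'', ''w'', ''adj'', ''row''} = {}"
  shows "ok k (sem c s)"
proof -
  have "sem c s x = s x" if "x \<in> {''n'', ''p'', ''B'', ''w'', ''adj'', ''row''}" for x
    using assms(2) that by (intro sem_frame) blast
  with assms(1) show ?thesis by (simp add: ok_def)
qed

lemma sem_count_prog:
  assumes "ok k s" "s u 0 < n" "u \<noteq> x" "u \<noteq> ''v''"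
    and "x \<notin> {''n'', ''adj'', ''row'', ''v''}" "S \<notin> {x, ''v''}"
  shows "sem (count_prog x u S) s x 0 = card (nbrs E (s u 0) - vset n (s S))"
proof -
  have "sem (count_prog x u S) s x 0 =
      (\<Sum>i<n. if i \<in> nbrs E (s u 0) - vset n (s S) then 1 else 0)"
    unfolding count_prog_def using assms
    by (subst sem_LSum) (auto simp: ok_def vset_def intro!: sum.cong)
  also have "\<dots> = card ({..<n} \<inter> (nbrs E (s u 0) - vset n (s S)))"
    by (simp add: sum.If_cases del: Diff_iff)
  also have "{..<n} \<inter> (nbrs E (s u 0) - vset n (s S)) = nbrs E (s u 0) - vset n (s S)"
    using nbrs_subset[of "s u 0"] by auto
  finally show ?thesis .
qed

lemma sem_phi_prog:
  assumes "ok k s"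
  shows "sem phi_prog s ''phi'' 0 = phi (s ''d'' 0) (vset n (s ''S''))"
proof -
  let ?S = "vset n (s ''S'')" and ?d = "s ''d'' 0"
  let ?f = "\<lambda>u. if u \<notin> ?S \<and> u \<noteq> p then Suc (card (nbrs E u - ?S)) - ?d else 0"
  let ?b = "LIf (Conj (Zero (At ''S'' ''u'')) (NotEq (Var ''u'') (Var ''p'')))
       (count_prog ''k'' ''u'' ''S'';;
        LSet ''phi'' (Plus (Var ''phi'') (Minus (Plus (Var ''k'') (Const 1)) (Var ''d''))))"
  define I where "I i s' \<longleftrightarrow> ok k s' \<and> s' ''S'' = s ''S'' \<and> s' ''d'' = s ''d'' \<and>
    s' ''phi'' 0 = (\<Sum>u<i. ?f u)" for i s'
  let ?s = "upd s ''phi'' 0 0"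
  have n: "?s ''n'' 0 = n" using assms by (simp add: ok_def)
  have "I 0 ?s" using assms by (simp add: I_def)
  moreover have "I (Suc i) (sem ?b (upd s' ''u'' 0 i))" if i: "i < ?s ''n'' 0" and I: "I i s'" for i s'
  proof -
    define s1 where "s1 = upd s' ''u'' 0 i"
    define s2 where "s2 = sem (count_prog ''k'' ''u'' ''S'') s1"
    have i: "i < n" using i n by simp
    have s1: "ok k s1" "s1 ''u'' 0 = i" "s1 ''S'' = s ''S''" "s1 ''d'' = s ''d''"
      "s1 ''phi'' 0 = (\<Sum>u<i. ?f u)" "s1 ''p'' 0 = p"
      using I by (simp_all add: I_def ok_def s1_def)
    have s2: "ok k s2" "s2 ''k'' 0 = card (nbrs E i - ?S)" "s2 ''S'' = s ''S''" "s2 ''d'' = s ''d''"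
      "s2 ''phi'' 0 = (\<Sum>u<i. ?f u)"
      using s1 i sem_count_prog[of k s1 "''u''" "''k''" "''S''"]
      by (simp_all add: ok_sem sem_frame s2_def)
    have "bval (Conj (Zero (At ''S'' ''u'')) (NotEq (Var ''u'') (Var ''p''))) s1 \<longleftrightarrow> i \<notin> ?S \<and> i \<noteq> p"
      using s1 i by (auto simp: vset_def)
    then have "sem ?b s1 = (if i \<notin> ?S \<and> i \<noteq> p
        then upd s2 ''phi'' 0 (s2 ''phi'' 0 + (s2 ''k'' 0 + 1 - s2 ''d'' 0)) else s1)"
      by (simp add: s2_def del: bval.simps)
    then show ?thesis
      using s1 s2 unfolding s1_def[symmetric] by (simp add: I_def)
  qed
  ultimately obtain s' where "I (?s ''n'' 0) s'" "sem (LFor ''u'' ''n'' ?b) ?s = upd s' ''u'' 0 (?s ''n'' 0)"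
    by (rule sem_for[of I ?s "''n''"])
  then show ?thesis unfolding n by (simp add: phi_prog_def I_def phi_def)
qed


lemma sem_gain_prog:
  assumes "ok k s" "s ''x'' 0 < n" "s ''F'' 0 = phi (s ''d'' 0) (vset n (s ''S''))"
  shows "sem gain_prog s ''g'' 0 = gain (s ''d'' 0) (vset n (s ''S'')) (s ''x'' 0)"
    and "sem gain_prog s ''S'' = s ''S''"
proof -
  let ?x = "s ''x'' 0"
  define s1 where "s1 = upd (upd s ''t'' 0 (s ''S'' ?x)) ''S'' ?x 1"
  define s2 where "s2 = sem phi_prog s1"
  have s1: "ok k s1" "s1 ''t'' 0 = s ''S'' ?x" "s1 ''S'' = (s ''S'')(?x := 1)"
    "s1 ''x'' = s ''x''" "s1 ''d'' = s ''d''" "s1 ''F'' = s ''F''"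
    using assms by (simp_all add: s1_def)
  have "s2 y = s1 y" if "y \<in> {''t'', ''S'', ''x'', ''F''}" for y
    using that unfolding s2_def by (intro sem_frame) auto
  then have s2: "s2 ''phi'' 0 = phi (s ''d'' 0) (insert ?x (vset n (s ''S'')))"
    "s2 ''t'' 0 = s ''S'' ?x" "s2 ''S'' = (s ''S'')(?x := 1)" "s2 ''x'' = s ''x''" "s2 ''F'' = s ''F''"
    using s1 sem_phi_prog[OF s1(1)] assms(2) by (simp_all add: s2_def)
  have "sem gain_prog s = (let s3 = upd s2 ''S'' ?x (s ''S'' ?x) in upd s3 ''g'' 0 (s3 ''F'' 0 - s3 ''phi'' 0))"
    using s2 by (simp add: gain_prog_def s2_def s1_def Let_def)
  then show "sem gain_prog s ''g'' 0 = gain (s ''d'' 0) (vset n (s ''S'')) (s ''x'' 0)"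
    and "sem gain_prog s ''S'' = s ''S''"
    using s2 assms(3) by (simp_all add: gain_def)
qed

text \<open>The counting loops yield the exact products because neither gain exceeds the number of
  rounds \<open>B\<close>.\<close>

lemma sem_compare_prog:
  assumes "ok k s" "s ''x'' 0 < n" "s ''g'' 0 \<le> s ''B'' 0" "s ''gb'' 0 \<le> s ''B'' 0"
  defines "better \<equiv> s ''gb'' 0 * w (s ''x'' 0) < s ''g'' 0 * s ''wb'' 0"
  shows "sem compare_prog s ''gb'' 0 = (if better then s ''g'' 0 else s ''gb'' 0)"
    and "sem compare_prog s ''wb'' 0 = (if better then w (s ''x'' 0) else s ''wb'' 0)"
    and "sem compare_prog s ''b'' 0 = (if better then s ''x'' 0 else s ''b'' 0)"
proof -
  have "s ''w'' (s ''x'' 0) = w (s ''x'' 0)" using assms by (simp add: ok_def)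
  then show "sem compare_prog s ''gb'' 0 = (if better then s ''g'' 0 else s ''gb'' 0)"
    and "sem compare_prog s ''wb'' 0 = (if better then w (s ''x'' 0) else s ''wb'' 0)"
    and "sem compare_prog s ''b'' 0 = (if better then s ''x'' 0 else s ''b'' 0)"
    using assms(3,4) unfolding better_def
    by (simp_all add: compare_prog_def sem_LSum sum_below_eq_mult cong del: if_weak_cong)
qed

lemma gain_le: "gain d S x \<le> n ^ Suc (Suc k)"
proof -
  have "gain d S x \<le> n * n * 1" using phi_le[of d S] by (simp add: gain_def)
  also have "\<dots> \<le> n * n * n ^ k" using p_less by (intro mult_le_mono2) simp
  finally show ?thesis by (simp add: mult.assoc)
qed

lemma sem_greedy_prog:
  assumes "ok k s"
  shows "greedy_choice (s ''d'' 0) (vset n (s ''S'')) (vset n (sem greedy_prog s ''S''))"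
proof -
  define d where "d = s ''d'' 0"
  define S where "S = vset n (s ''S'')"
  \<comment> \<open>A nonzero \<open>gb\<close> belongs to a vertex \<open>b\<close> that is best
    among those below \<open>i\<close>. Positivity of \<open>wb\<close> is kept because
    \<open>wb\<close> gets cancelled when ratios are compared.\<close>
  define I where "I i s' \<longleftrightarrow> ok k s' \<and> s' ''S'' = s ''S'' \<and> s' ''d'' 0 = d \<and> s' ''F'' 0 = phi d S \<and>
    0 < s' ''wb'' 0 \<and>
    (0 < s' ''gb'' 0 \<longrightarrow> s' ''b'' 0 \<in> U \<and> s' ''gb'' 0 = gain d S (s' ''b'' 0) \<and> s' ''wb'' 0 = w (s' ''b'' 0)) \<and>
    (\<forall>x\<in>U. x < i \<longrightarrow> gain d S x * s' ''wb'' 0 \<le> s' ''gb'' 0 * w x)" for i s'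
  let ?init = "phi_prog;; LSet ''F'' (Var ''phi'');; LSet ''gb'' (Const 0);;
     LSet ''wb'' (Const 1);; LSet ''b'' (Const 0)"
  let ?c = "Conj (NotEq (Var ''x'') (Var ''p'')) (Zero (Adj ''p'' ''x''))"
  define s0 where "s0 = sem ?init s"
  have s0: "I 0 s0"
    using assms sem_phi_prog[OF assms] by (simp add: I_def s0_def ok_sem sem_frame d_def S_def)
  then have n: "s0 ''n'' 0 = n" by (simp add: I_def ok_def)
  have step: "I (Suc i) (sem (LIf ?c (gain_prog;; compare_prog)) (upd s' ''x'' 0 i))"
    if "i < s0 ''n'' 0" and I: "I i s'" for i s'
  proof -
    have i: "i < n" using that n by simp
    define s1 where "s1 = upd s' ''x'' 0 i"
    define s2 where "s2 = sem gain_prog s1"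
    define s3 where "s3 = sem compare_prog s2"
    have s1: "ok k s1" "s1 ''S'' = s ''S''" "s1 ''d'' 0 = d" "s1 ''F'' 0 = phi d S" "s1 ''x'' 0 = i"
      "s1 ''wb'' = s' ''wb''" "s1 ''gb'' = s' ''gb''" "s1 ''b'' = s' ''b''"
      using I by (simp_all add: I_def s1_def)
    then have "s1 ''p'' 0 = p" "s1 ''adj'' (s1 ''row'' p + i) = (if i \<in> nbrs E p then 1 else 0)"
      using i p_less by (simp_all add: ok_def)
    then have c: "bval ?c s1 \<longleftrightarrow> i \<in> U" using s1(5) i by auto
    have gbB: "s' ''gb'' 0 \<le> n ^ Suc (Suc k)"
      using I gain_le by (cases "s' ''gb'' 0 = 0") (auto simp: I_def simp del: power_Suc)
    show ?thesis
    proof (cases "i \<in> U")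
      case False
      then have "sem (LIf ?c (gain_prog;; compare_prog)) s1 = s1" by (simp only: sem.simps c if_False)
      moreover have "I (Suc i) s1" using I False s1 by (auto simp: I_def less_Suc_eq)
      ultimately show ?thesis by (simp add: s1_def)
    next
      case True
      then have eq: "sem (LIf ?c (gain_prog;; compare_prog)) s1 = s3"
        using c by (simp add: s3_def s2_def del: bval.simps)
      have s2: "ok k s2" "s2 ''S'' = s ''S''" "s2 ''d'' 0 = d" "s2 ''F'' 0 = phi d S" "s2 ''x'' 0 = i"
        "s2 ''wb'' = s' ''wb''" "s2 ''gb'' = s' ''gb''" "s2 ''b'' = s' ''b''" "s2 ''g'' 0 = gain d S i"
        using s1 i sem_gain_prog[of k s1] by (simp_all add: s2_def ok_sem sem_frame S_def)
      have B: "s2 ''B'' 0 = n ^ Suc (Suc k)" using s2(1) by (simp add: ok_def)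
      define better where "better \<longleftrightarrow> s' ''gb'' 0 * w i < gain d S i * s' ''wb'' 0"
      have s3: "ok k s3" "s3 ''S'' = s ''S''" "s3 ''d'' 0 = d" "s3 ''F'' 0 = phi d S"
        "s3 ''gb'' 0 = (if better then gain d S i else s' ''gb'' 0)"
        "s3 ''wb'' 0 = (if better then w i else s' ''wb'' 0)"
        "s3 ''b'' 0 = (if better then i else s' ''b'' 0)"
        using s2 i sem_compare_prog[of k s2] B gain_le[of d S i k] gbB
        by (simp_all add: s3_def ok_sem sem_frame better_def del: power_Suc)
      have "I (Suc i) s3"
      proof (cases better)
        case False
        then show ?thesis using I s3 by (auto simp: I_def less_Suc_eq better_def)
      next
        case b: True
        \<comment> \<open>Transitivity of the ratio comparison: both sides are multiplied by
          \<open>wb\<close>, chained through the old best ratio, and \<open>wb\<close> is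
          cancelled.\<close>
        have "gain d S x * w i \<le> gain d S i * w x" if "x \<in> U" "x < i" for x
        proof -
          have "gain d S x * w i * s' ''wb'' 0 = gain d S x * s' ''wb'' 0 * w i" by simp
          also have "\<dots> \<le> s' ''gb'' 0 * w x * w i" using I that by (intro mult_le_mono1) (simp add: I_def)
          also have "\<dots> = s' ''gb'' 0 * w i * w x" by simp
          also have "\<dots> \<le> gain d S i * s' ''wb'' 0 * w x"
            using b by (intro mult_le_mono1) (simp add: better_def)
          finally have "gain d S x * w i * s' ''wb'' 0 \<le> gain d S i * w x * s' ''wb'' 0"
            by (simp add: mult_ac)
          then show ?thesis using I by (simp add: I_def)
        qed
        then show ?thesis using b s3 True w_pos[OF i] by (auto simp: I_def less_Suc_eq)
      qed
      then show ?thesis using eq by (simp add: s1_def)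
    qed
  qed
  from s0 step obtain s' where s': "I (s0 ''n'' 0) s'"
    "sem (LFor ''x'' ''n'' (LIf ?c (gain_prog;; compare_prog))) s0 = upd s' ''x'' 0 (s0 ''n'' 0)"
    by (rule sem_for[of I s0 "''n''"])
  let ?s = "upd s' ''x'' 0 n"
  have "sem greedy_prog s = sem (LIf (NonZero (Var ''gb'')) (LWrite ''S'' (Var ''b'') (Const 1)))
      (sem (LFor ''x'' ''n'' (LIf ?c (gain_prog;; compare_prog))) s0)"
    by (simp only: greedy_prog_def s0_def sem.simps(3))
  also have "\<dots> = (if 0 < s' ''gb'' 0 then upd ?s ''S'' (s' ''b'' 0) 1 else ?s)"
    unfolding s'(2) n by simp
  finally have "sem greedy_prog s = (if 0 < s' ''gb'' 0 then upd ?s ''S'' (s' ''b'' 0) 1 else ?s)" .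
  moreover have "vset n (s' ''S'') = S" using s'(1) by (simp add: I_def S_def)
  ultimately have S': "vset n (sem greedy_prog s ''S'') =
      (if 0 < s' ''gb'' 0 then insert (s' ''b'' 0) S else S)"
    using s'(1) by (auto simp: I_def)
  have "greedy_choice d S (vset n (sem greedy_prog s ''S''))"
  proof (cases "0 < s' ''gb'' 0")
    case True
    have b: "s' ''b'' 0 \<in> U" "s' ''gb'' 0 = gain d S (s' ''b'' 0)" "s' ''wb'' 0 = w (s' ''b'' 0)"
      and "\<forall>x\<in>U. gain d S x * s' ''wb'' 0 \<le> s' ''gb'' 0 * w x"
      using s'(1) True unfolding n I_def by auto
    then have "0 < gain d S (s' ''b'' 0)"
      "\<forall>x\<in>U. gain d S x * w (s' ''b'' 0) \<le> gain d S (s' ''b'' 0) * w x"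
      using True by simp_all
    with b(1) show ?thesis unfolding greedy_choice_def S' if_P[OF True] by blast
  next
    case False
    have "gain d S x = 0" if "x \<in> U" for x
    proof -
      have "gain d S x * s' ''wb'' 0 \<le> s' ''gb'' 0 * w x" "0 < s' ''wb'' 0"
        using s'(1) that unfolding n I_def by auto
      then show ?thesis using False by simp
    qed
    then have "\<forall>x\<in>U. gain d S x = 0" by blast
    then show ?thesis unfolding greedy_choice_def S' if_not_P[OF False] by blast
  qed
  then show ?thesis by (simp add: d_def S_def)
qed

text \<open>The first claim holds even for an \<open>m\<close> that encodes no subset, so every
  round works on some subset of \<open>L\<close>; the second makes the enumeration reach each
  subset.\<close>

lemma sem_decode_prog:
  assumes "ok k s" "vset n (s ''L'') = L" "s ''m'' 0 \<le> s ''B'' 0"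
  defines "T \<equiv> vset n (sem decode_prog s ''S'')"
  shows "T \<subseteq> L" and "T' \<subseteq> L \<Longrightarrow> enc n L T' n = s ''m'' 0 \<Longrightarrow> T = T'"
proof -
  \<comment> \<open>\<open>enc\<close> recurses from the last vertex backwards, so after
    \<open>i\<close> rounds \<open>h\<close> is the code of the last \<open>n - i\<close> vertices.
    Keeping \<open>h\<close> at most \<open>m\<close>, hence at most \<open>B\<close>, makes the
    halving loop long enough.\<close>
  define I where "I i s' \<longleftrightarrow> ok k s' \<and> s' ''L'' = s ''L'' \<and> s' ''h'' 0 \<le> s ''m'' 0 \<and>
    (\<forall>j<i. s' ''S'' j \<noteq> 0 \<longrightarrow> j \<in> L) \<and>
    (\<forall>T'\<subseteq>L. enc n L T' n = s ''m'' 0 \<longrightarrow> s' ''h'' 0 = enc n L T' (n - i) \<and>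
       (\<forall>j<i. s' ''S'' j \<noteq> 0 \<longleftrightarrow> j \<in> T'))" for i s'
  let ?s = "upd s ''h'' 0 (s ''m'' 0)"
  let ?q = "LSum ''q'' ''j'' ''B'' (Less (Plus (Plus (Var ''j'') (Var ''j'')) (Const 1)) (Var ''h'')) (Const 1)"
  let ?b = "LWrite ''S'' (Var ''i'') (Const 0);; LIf (NonZero (At ''L'' ''i'')) (?q;;
        LWrite ''S'' (Var ''i'') (Minus (Var ''h'') (Plus (Var ''q'') (Var ''q'')));; LSet ''h'' (Var ''q''))"
  have n: "?s ''n'' 0 = n" using assms(1) by (simp add: ok_def)
  have B: "s ''B'' 0 = n ^ Suc (Suc k)" using assms(1) by (simp add: ok_def)
  have "I 0 ?s" using assms(1) by (simp add: I_def)
  moreover have "I (Suc i) (sem ?b (upd s' ''i'' 0 i))" if "i < ?s ''n'' 0" and I: "I i s'" for i s'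
  proof -
    have i: "i < n" using that n by simp
    then have ni: "n - i = Suc (n - Suc i)" "n - Suc (n - Suc i) = i" by auto
    define s1 where "s1 = upd (upd s' ''i'' 0 i) ''S'' i 0"
    have s1: "ok k s1" "s1 ''L'' = s ''L''" "s1 ''h'' = s' ''h''" "s1 ''S'' = (s' ''S'')(i := 0)"
      "s1 ''i'' 0 = i"
      using I by (simp_all add: I_def s1_def)
    have L: "s ''L'' i \<noteq> 0 \<longleftrightarrow> i \<in> L" using assms(2) i by (auto simp: vset_def)
    show ?thesis
    proof (cases "i \<in> L")
      case False
      have "sem ?b (upd s' ''i'' 0 i) = s1"
        using False s1 L by (simp add: s1_def)
      moreover have "I (Suc i) s1"
        using False I s1 by (auto simp: I_def less_Suc_eq ni)
      ultimately show ?thesis by simp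
    next
      case True
      define s2 where "s2 = sem ?q s1"
      define s3 where "s3 = upd (upd s2 ''S'' i (s' ''h'' 0 - (s2 ''q'' 0 + s2 ''q'' 0))) ''h'' 0 (s2 ''q'' 0)"
      have "s2 y = s1 y" if "y \<in> {''S'', ''h'', ''i'', ''L''}" for y
        using that unfolding s2_def by (intro sem_frame) auto
      moreover have "ok k s2" unfolding s2_def using s1 by (intro ok_sem) auto
      moreover have "s' ''h'' 0 \<le> s1 ''B'' 0" using I assms(3) B s1(1) by (simp add: I_def ok_def)
      then have "s2 ''q'' 0 = s' ''h'' 0 div 2"
        using s1 by (simp add: s2_def sem_LSum sum_below_half cong del: if_weak_cong)
      ultimately have s2: "ok k s2" "s2 ''L'' = s ''L''" "s2 ''h'' = s' ''h''" "s2 ''S'' = (s' ''S'')(i := 0)"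
        "s2 ''i'' 0 = i" "s2 ''q'' 0 = s' ''h'' 0 div 2"
        using s1 by simp_all
      have "s' ''h'' 0 - (s' ''h'' 0 div 2 + s' ''h'' 0 div 2) = s' ''h'' 0 mod 2" by presburger
      then have s3: "ok k s3" "s3 ''L'' = s ''L''" "s3 ''h'' 0 = s' ''h'' 0 div 2"
        "s3 ''S'' = (s' ''S'')(i := s' ''h'' 0 mod 2)"
        using s2 by (simp_all add: s3_def fun_upd_same del: fun_upd_apply)
      have "s1 ''L'' i \<noteq> 0" using s1 L True by simp
      then have "sem ?b (upd s' ''i'' 0 i) = sem (?q;;
          LWrite ''S'' (Var ''i'') (Minus (Var ''h'') (Plus (Var ''q'') (Var ''q'')));; LSet ''h'' (Var ''q'')) s1"
        by (simp add: s1_def)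
      also have "\<dots> = sem (LWrite ''S'' (Var ''i'') (Minus (Var ''h'') (Plus (Var ''q'') (Var ''q'')));;
          LSet ''h'' (Var ''q'')) s2"
        by (simp only: s2_def sem.simps(3))
      also have "\<dots> = s3" using s2 by (simp add: s3_def)
      finally have eq: "sem ?b (upd s' ''i'' 0 i) = s3" .
      have "s3 ''h'' 0 = enc n L T' (n - Suc i) \<and> (\<forall>j<Suc i. s3 ''S'' j \<noteq> 0 \<longleftrightarrow> j \<in> T')"
        if "T' \<subseteq> L" "enc n L T' n = s ''m'' 0" for T'
      proof -
        have "s' ''h'' 0 = enc n L T' (n - i)" and S: "\<forall>j<i. s' ''S'' j \<noteq> 0 \<longleftrightarrow> j \<in> T'"
          using I that by (simp_all add: I_def)
        then have h: "s' ''h'' 0 = of_bool (i \<in> T') + 2 * enc n L T' (n - Suc i)"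
          using True by (simp add: ni)
        then have "s' ''h'' 0 mod 2 = of_bool (i \<in> T')" "s' ''h'' 0 div 2 = enc n L T' (n - Suc i)"
          by (auto split: if_splits)
        then show ?thesis using S s3 by (auto simp: less_Suc_eq)
      qed
      then have "I (Suc i) s3"
        using I s3 True by (auto simp: I_def less_Suc_eq)
      then show ?thesis using eq by simp
    qed
  qed
  ultimately obtain s' where s': "I (?s ''n'' 0) s'"
    "sem (LFor ''i'' ''n'' ?b) ?s = upd s' ''i'' 0 (?s ''n'' 0)"
    by (rule sem_for[of I ?s "''n''"])
  then have "sem decode_prog s ''S'' = s' ''S''" by (simp add: decode_prog_def del: sem.simps(5))
  then have T: "T = vset n (s' ''S'')" by (simp add: T_def)
  show "T \<subseteq> L" using s'(1) n by (auto simp: T vset_def I_def)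
  have "L \<subseteq> {..<n}" using assms(2) by (auto simp: vset_def)
  then show "T = T'" if "T' \<subseteq> L" "enc n L T' n = s ''m'' 0"
    using s'(1) n that by (auto simp: T vset_def I_def)
qed

text \<open>The value of \<open>B\<close> is the round number in \<open>candidate\<close>, so
  \<open>greedy_inv\<close> itself serves as the loop invariant.\<close>

lemma sem_candidate_prog:
  assumes "ok k s" "vset n (s ''L'') = L" "s ''m'' 0 \<le> s ''B'' 0"
  obtains T where "T \<subseteq> L" "\<And>T'. T' \<subseteq> L \<Longrightarrow> enc n L T' n = s ''m'' 0 \<Longrightarrow> T = T'"
    "candidate k T (vset n (sem candidate_prog s ''S''))"
    "sem candidate_prog s ''d'' 0 = card (nbrs E p - T)"
proof -
  define s1 where "s1 = sem decode_prog s"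
  define T where "T = vset n (s1 ''S'')"
  define s2 where "s2 = sem (count_prog ''d'' ''p'' ''S'') s1"
  define d where "d = card (nbrs E p - T)"
  have s1: "ok k s1" unfolding s1_def using assms by (intro ok_sem) auto
  then have "s1 ''p'' 0 = p" by (simp add: ok_def)
  then have s2: "ok k s2" "s2 ''S'' = s1 ''S''" "s2 ''d'' 0 = d"
    using s1 p_less sem_count_prog[OF s1, of "''p''" "''d''" "''S''"]
    by (simp_all add: s2_def d_def T_def ok_sem sem_frame)
  define I where "I i s' \<longleftrightarrow> ok k s' \<and> s' ''d'' 0 = d \<and> greedy_inv d T i (vset n (s' ''S''))" for i s'
  have "I 0 s2" using s2 by (simp add: I_def greedy_inv_0 T_def)
  moreover have "I (Suc i) (sem greedy_prog (upd s' ''r'' 0 i))" if "I i s'" for i s'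
  proof -
    define s3 where "s3 = upd s' ''r'' 0 i"
    have s3: "ok k s3" "s3 ''d'' 0 = d" "greedy_inv d T i (vset n (s3 ''S''))"
      using that by (simp_all add: I_def s3_def)
    have "greedy_inv d T (Suc i) (vset n (sem greedy_prog s3 ''S''))"
      using sem_greedy_prog[OF s3(1)] s3 by (intro greedy_inv_Suc) (auto simp: T_def)
    then show ?thesis using s3 by (simp add: I_def s3_def[symmetric] ok_sem sem_frame)
  qed
  ultimately obtain s' where s': "I (s2 ''B'' 0) s'"
    "sem (LFor ''r'' ''B'' greedy_prog) s2 = upd s' ''r'' 0 (s2 ''B'' 0)"
    by (rule sem_for[of I s2 "''B''"])
  have "sem candidate_prog s = upd s' ''r'' 0 (s2 ''B'' 0)"
    using s'(2) by (simp add: candidate_prog_def s1_def s2_def del: sem.simps(5))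
  moreover have "s2 ''B'' 0 = n ^ Suc (Suc k)" using s2(1) by (simp add: ok_def)
  ultimately have "candidate k T (vset n (sem candidate_prog s ''S''))"
    "sem candidate_prog s ''d'' 0 = card (nbrs E p - T)"
    using s'(1) by (simp_all add: candidate_def I_def d_def)
  with sem_decode_prog[OF assms] show thesis
    by (intro that[of T]) (auto simp: T_def s1_def)
qed

lemma sem_record_prog:
  assumes "ok k s"
  defines "S \<equiv> vset n (s ''S'')"
  defines "better \<equiv> phi (s ''d'' 0) S = 0 \<and> sum w S < s ''bw'' 0"
  shows "sem record_prog s ''bw'' 0 = (if better then sum w S else s ''bw'' 0)"
    and "vset n (sem record_prog s ''out'') = (if better then S else vset n (s ''out''))"
proof -
  let ?sum = "LSum ''cost'' ''i'' ''n'' (NonZero (At ''S'' ''i'')) (At ''w'' ''i'')"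
  let ?b = "LWrite ''out'' (Var ''i'') (At ''S'' ''i'')"
  define s1 where "s1 = sem phi_prog s"
  define s2 where "s2 = sem ?sum s1"
  define s3 where "s3 = upd s2 ''bw'' 0 (s2 ''cost'' 0)"
  have s1: "ok k s1" "s1 ''phi'' 0 = phi (s ''d'' 0) S" "s1 ''S'' = s ''S''" "s1 ''bw'' = s ''bw''"
    "s1 ''out'' = s ''out''"
    using assms(1) sem_phi_prog[OF assms(1)] by (simp_all add: s1_def S_def ok_sem sem_frame)
  have "s2 ''cost'' 0 = (\<Sum>i<n. if s ''S'' i \<noteq> 0 then w i else 0)"
    unfolding s2_def using s1 by (subst sem_LSum) (auto simp: ok_def intro!: sum.cong)
  also have "\<dots> = sum w ({..<n} \<inter> {i. s ''S'' i \<noteq> 0})" by (simp add: sum.If_cases)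
  also have "{..<n} \<inter> {i. s ''S'' i \<noteq> 0} = S" by (auto simp: S_def vset_def)
  finally have s2: "ok k s2" "s2 ''cost'' 0 = sum w S" "s2 ''phi'' 0 = phi (s ''d'' 0) S"
    "s2 ''S'' = s ''S''" "s2 ''bw'' = s ''bw''" "s2 ''out'' = s ''out''"
    using s1 by (simp_all add: s2_def ok_sem sem_frame)
  have n: "s3 ''n'' 0 = n" using s2 by (simp add: s3_def ok_def)
  define I where "I i s' \<longleftrightarrow> s' ''S'' = s ''S'' \<and> s' ''bw'' 0 = sum w S \<and> (\<forall>j<i. s' ''out'' j = s ''S'' j)"
    for i s'
  have "I 0 s3" using s2 by (simp add: I_def s3_def)
  moreover have "I (Suc i) (sem ?b (upd s' ''i'' 0 i))" if "I i s'" for i s'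
    using that by (auto simp: I_def less_Suc_eq)
  ultimately obtain s' where s': "I (s3 ''n'' 0) s'"
    "sem (LFor ''i'' ''n'' ?b) s3 = upd s' ''i'' 0 (s3 ''n'' 0)"
    by (rule sem_for[of I s3 "''n''"])
  have "sem record_prog s = (if better then upd s' ''i'' 0 n else s2)"
    using s'(2) s2 n
    by (simp add: record_prog_def s1_def[symmetric] s2_def[symmetric] s3_def better_def del: sem.simps(5))
  moreover have "vset n (s' ''out'') = S" using s'(1) n by (auto simp: I_def S_def vset_def)
  ultimately show "sem record_prog s ''bw'' 0 = (if better then sum w S else s ''bw'' 0)"
    and "vset n (sem record_prog s ''out'') = (if better then S else vset n (s ''out''))"
    using s'(1) s2 by (simp_all add: I_def)
qed

text \<open>Every pass over the vertices enlarges the set or finds it complete. A set still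
  incomplete after \<open>n\<close> passes would have at least \<open>n\<close> elements, too many
  for a subset of \<open>N(p)\<close>.\<close>

lemma sem_L_prog:
  assumes "ok k s" "\<forall>i. s ''L'' i = 0"
  shows "L_produced E p (vset n (sem L_prog s ''L''))"
proof -
  let ?L = "\<lambda>s. vset n (s ''L'')"
  let ?b = "count_prog ''a'' ''u'' ''L'';; count_prog ''c'' ''p'' ''L'';;
     LIf (Conj (Conj (NonZero (Adj ''p'' ''u'')) (Zero (At ''L'' ''u''))) (Neg (Less (Var ''a'') (Var ''c''))))
       (LWrite ''L'' (Var ''u'') (Const 1))"
  define J where "J r s' \<longleftrightarrow> ok k s' \<and> L_reachable E p (?L s') \<and>
    (r \<le> card (?L s') \<or> \<not> (\<exists>u. can_add E p (?L s') u))" for r s'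
  have "?L s = {}" using assms(2) by (simp add: vset_def)
  then have J0: "J 0 s" using assms(1) by (simp add: J_def L_reachable.start)
  have outer: "J (Suc r) (sem (LFor ''u'' ''n'' ?b) (upd s0 ''r'' 0 r))" if J: "J r s0" for r s0
  proof -
    define s1 where "s1 = upd s0 ''r'' 0 r"
    define L0 where "L0 = ?L s1"
    have s1: "ok k s1" "L_reachable E p L0" "r \<le> card L0 \<or> \<not> (\<exists>u. can_add E p L0 u)"
      using J by (simp_all add: J_def s1_def L0_def)
    \<comment> \<open>By \<open>can_add_mono\<close>, a vertex addable at the start of the pass
      stays addable until it is added. The last conjunct says that growth shows \<open>L0\<close> to
      be incomplete, which yields \<open>r \<le> card L0\<close>.\<close>
    define I where "I i s' \<longleftrightarrow> ok k s' \<and> L_reachable E p (?L s') \<and> L0 \<subseteq> ?L s' \<and>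
      (\<forall>u<i. can_add E p L0 u \<longrightarrow> u \<in> ?L s') \<and> (?L s' = L0 \<or> (\<exists>u. can_add E p L0 u))" for i s'
    have n: "s1 ''n'' 0 = n" using s1 by (simp add: ok_def)
    have "I 0 s1" using s1 by (simp add: I_def L0_def)
    moreover have "I (Suc i) (sem ?b (upd s' ''u'' 0 i))" if "i < s1 ''n'' 0" and I: "I i s'" for i s'
    proof -
      have i: "i < n" using that n by simp
      define s2 where "s2 = upd s' ''u'' 0 i"
      define s3 where "s3 = sem (count_prog ''a'' ''u'' ''L'') s2"
      define s4 where "s4 = sem (count_prog ''c'' ''p'' ''L'') s3"
      have s2: "ok k s2" "s2 ''u'' 0 = i" "s2 ''L'' = s' ''L''" "s2 ''p'' 0 = p"
        using I by (simp_all add: I_def s2_def ok_def)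
      then have s3: "ok k s3" "s3 ''u'' 0 = i" "s3 ''L'' = s' ''L''" "s3 ''p'' 0 = p"
        "s3 ''a'' 0 = card (nbrs E i - ?L s')"
        using sem_count_prog[OF s2(1), of "''u''" "''a''" "''L''"] i
        by (simp_all add: s3_def ok_sem sem_frame)
      then have s4: "ok k s4" "s4 ''u'' 0 = i" "s4 ''L'' = s' ''L''" "s4 ''p'' 0 = p"
        "s4 ''a'' 0 = card (nbrs E i - ?L s')" "s4 ''c'' 0 = card (nbrs E p - ?L s')"
        using sem_count_prog[OF s3(1), of "''p''" "''c''" "''L''"] p_less
        by (simp_all add: s4_def ok_sem sem_frame)
      then have adj: "s4 ''adj'' (s4 ''row'' p + i) = (if i \<in> nbrs E p then 1 else 0)"
        using i p_less by (simp add: ok_def)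
      have "sem ?b s2 = (if can_add E p (?L s') i then upd s4 ''L'' i 1 else s4)"
        using s4 adj i by (auto simp: s3_def[symmetric] s4_def[symmetric] can_add_def vset_def)
      then have eq: "sem ?b (upd s' ''u'' 0 i) = (if can_add E p (?L s') i then upd s4 ''L'' i 1 else s4)"
        by (simp add: s2_def)
      have R: "L_reachable E p (?L s')" "L0 \<subseteq> ?L s'" using I by (simp_all add: I_def)
      have mono: "can_add E p (?L s') i" if "can_add E p L0 i" "i \<notin> ?L s'"
        using can_add_mono[OF graph that(1) R(2) L_reachable_subset[OF R(1)] that(2)] .
      show ?thesis
      proof (cases "can_add E p (?L s') i")
        case True
        then have "L_reachable E p (insert i (?L s'))" using R by (intro L_reachable.add)
        moreover have "\<exists>u. can_add E p L0 u" using I True by (auto simp: I_def)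
        ultimately show ?thesis using I True i s4 unfolding eq by (auto simp: I_def less_Suc_eq)
      next
        case False
        then show ?thesis using I mono s4 unfolding eq by (auto simp: I_def less_Suc_eq)
      qed
    qed
    ultimately obtain s' where s': "I (s1 ''n'' 0) s'"
      "sem (LFor ''u'' ''n'' ?b) s1 = upd s' ''u'' 0 (s1 ''n'' 0)"
      by (rule sem_for[of I s1 "''n''"])
    have I: "I n s'" using s'(1) n by simp
    have "Suc r \<le> card (?L s') \<or> \<not> (\<exists>u. can_add E p (?L s') u)"
    proof (cases "?L s' = L0")
      case True
      have "u < n \<and> u \<notin> L0" if "can_add E p L0 u" for u
        using that nbrs_subset[of p] by (auto simp: can_add_def)
      then show ?thesis using I True by (auto simp: I_def)
    next
      case False
      then have "L0 \<subset> ?L s'" using I by (auto simp: I_def)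
      then have "card L0 < card (?L s')" by (intro psubset_card_mono) simp_all
      then show ?thesis using I False s1(3) by (auto simp: I_def)
    qed
    then show ?thesis using I s'(2) unfolding s1_def[symmetric]
      by (simp add: J_def I_def del: sem.simps(5))
  qed
  have n: "s ''n'' 0 = n" using assms(1) by (simp add: ok_def)
  from J0 outer obtain s' where s': "J (s ''n'' 0) s'"
    "sem (LFor ''r'' ''n'' (LFor ''u'' ''n'' ?b)) s = upd s' ''r'' 0 (s ''n'' 0)"
    by (rule sem_for[of J s "''n''"])
  have eq: "sem L_prog s ''L'' = s' ''L''" using s'(2) by (simp add: L_prog_def del: sem.simps(5))
  have J: "J n s'" using s'(1) n by simp
  then have "?L s' \<subseteq> {..<n} - {p}"
    using L_reachable_subset[of E p "?L s'"] nbrs_subset[of p] by (auto simp: J_def)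
  then have "card (?L s') \<le> card ({..<n} - {p})" by (intro card_mono) auto
  also have "\<dots> < n" using p_less by simp
  finally show ?thesis using J by (auto simp: eq J_def L_produced_def)
qed

lemma sem_row_prog:
  assumes "s ''n'' 0 = n" "s ''row'' 0 = 0" "i < n"
  shows "sem row_prog s ''row'' i = i * n"
proof -
  let ?b = "LWrite ''row'' (Plus (Var ''i'') (Const 1)) (Plus (At ''row'' ''i'') (Var ''n''))"
  define I where "I i s' \<longleftrightarrow> s' ''n'' 0 = n \<and> (\<forall>j\<le>i. s' ''row'' j = j * n)" for i s'
  have "I 0 s" using assms by (simp add: I_def)
  moreover have "I (Suc i) (sem ?b (upd s' ''i'' 0 i))" if "I i s'" for i s'
    using that by (auto simp: I_def le_Suc_eq)
  ultimately obtain s' where "I (s ''n'' 0) s'" "sem (LFor ''i'' ''n'' ?b) s = upd s' ''i'' 0 (s ''n'' 0)"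
    by (rule sem_for[of I s "''n''"])
  then show ?thesis using assms by (simp add: row_prog_def I_def del: sem.simps(5))
qed

section \<open>The whole run on an encoded instance\<close>

lemma ok_input:
  fixes k :: nat
  defines "s \<equiv> sem (pow_prog (Suc (Suc k))) (input_state n E p w)"
  shows "ok k (sem row_prog s)" "\<forall>i. sem row_prog s ''L'' i = 0"
proof -
  have fr: "s y = input_state n E p w y" if "y \<notin> {''B'', ''q'', ''i''}" for y
    unfolding s_def using that pow_prog_ok(2)[of "Suc (Suc k)"] by (intro sem_frame) blast
  have B: "s ''B'' 0 = n ^ Suc (Suc k)"
    unfolding s_def by (subst sem_pow_prog) (simp add: input_state_def)
  have s: "s ''n'' 0 = n" "s ''row'' 0 = 0" "s ''p'' 0 = p" "\<forall>i<n. s ''w'' i = w i" "\<forall>i. s ''L'' i = 0"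
    by (auto simp: fr input_state_def)
  have adj: "s ''adj'' (u * n + v) = (if v \<in> nbrs E u then 1 else 0)" if "u < n" "v < n" for u v
  proof -
    have "(u * n + v) div n = u" "(u * n + v) mod n = v" using that by auto
    moreover have "u * n + v < n * n"
    proof -
      have "u * n + v < Suc u * n" using that by simp
      also have "\<dots> \<le> n * n" using that by (intro mult_le_mono1) simp
      finally show ?thesis .
    qed
    ultimately show ?thesis by (simp add: fr input_state_def nbrs_def insert_commute)
  qed
  show "ok k (sem row_prog s)"
    using s B adj sem_row_prog[of s] by (simp add: ok_def sem_frame del: power_Suc)
  show "\<forall>i. sem row_prog s ''L'' i = 0" using s by (simp add: sem_frame)
qed

text \<open>The round whose \<open>m\<close> encodes the good \<open>T\<close> of
  \<open>exists_good_candidate\<close> produces a feasible set within the bound, and from then on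
  the recorded weight is no larger.\<close>

lemma main_prog_correct:
  assumes L: "L_produced E p L" and small: "2 ^ card L \<le> n ^ Suc (Suc k)"
  defines "S \<equiv> output_set n (sem main_prog (sem (pow_prog (Suc (Suc k))) (input_state n E p w)))"
  shows "feasible {..<n} E p S"
    and "real (sum w S) \<le> 4 * log 2 (real n) * real (min_weight {..<n} E p w)"
proof -
  define W where "W = (\<Sum>i<n. w i)"
  let ?sum = "LSum ''bw'' ''i'' ''n'' (NonZero (Const 1)) (At ''w'' ''i'')"
  define s0 where "s0 = sem (pow_prog (Suc (Suc k))) (input_state n E p w)"
  define s1 where "s1 = sem row_prog s0"
  define s2 where "s2 = sem L_prog s1"
  define s3 where "s3 = sem ?sum s2"
  have s1: "ok k s1" "\<forall>i. s1 ''L'' i = 0" using ok_input by (simp_all add: s1_def s0_def)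
  have "L_produced E p (vset n (s2 ''L''))" unfolding s2_def by (rule sem_L_prog[OF s1])
  \<comment> \<open>The program may add vertices in another order than the one behind
    \<open>L\<close>; uniqueness of the result identifies both sets.\<close>
  then have "vset n (s2 ''L'') = L" by (rule L_produced_unique[OF graph _ L])
  moreover have "ok k s2" unfolding s2_def using s1 by (intro ok_sem) auto
  moreover from this have "s3 ''bw'' 0 = W"
    by (simp add: s3_def sem_LSum ok_def W_def cong del: if_weak_cong)
  ultimately have s3: "ok k s3" "vset n (s3 ''L'') = L" "s3 ''bw'' 0 = W"
    by (simp_all add: s3_def ok_sem sem_frame)
  have Lp: "L \<subseteq> nbrs E p" using L by (simp add: L_produced_def L_reachable_subset)
  let ?out = "\<lambda>s. vset n (s ''out'')"
  \<comment> \<open>\<open>bw < W\<close> signals that \<open>out\<close> holds a feasible set of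
    weight \<open>bw\<close>. For each subset already met, the record is at most the weight of some
    candidate for it, if that candidate is feasible.\<close>
  define I where "I i s' \<longleftrightarrow> ok k s' \<and> vset n (s' ''L'') = L \<and>
    (s' ''bw'' 0 < W \<longrightarrow> feasible {..<n} E p (?out s') \<and> sum w (?out s') = s' ''bw'' 0) \<and>
    (\<forall>T\<subseteq>L. enc n L T n < i \<longrightarrow>
       (\<exists>S. candidate k T S \<and> (feasible {..<n} E p S \<longrightarrow> s' ''bw'' 0 \<le> sum w S)))" for i s'
  have B: "s3 ''B'' 0 = n ^ Suc (Suc k)" using s3 by (simp add: ok_def)
  have "I 0 s3" using s3 by (simp add: I_def)
  moreover have "I (Suc i) (sem (candidate_prog;; record_prog) (upd s' ''m'' 0 i))"
    if "i < s3 ''B'' 0" and I: "I i s'" for i s'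
  proof -
    define t1 where "t1 = upd s' ''m'' 0 i"
    define t2 where "t2 = sem candidate_prog t1"
    define t3 where "t3 = sem record_prog t2"
    define S where "S = vset n (t2 ''S'')"
    have t1: "ok k t1" "vset n (t1 ''L'') = L" "t1 ''m'' 0 = i" "t1 ''bw'' = s' ''bw''"
      "t1 ''out'' = s' ''out''"
      using I by (simp_all add: I_def t1_def)
    have "t1 ''m'' 0 \<le> t1 ''B'' 0" using that(1) t1 B by (simp add: ok_def)
    from sem_candidate_prog[OF t1(1,2) this] obtain T where T: "T \<subseteq> L"
      "\<And>T'. T' \<subseteq> L \<Longrightarrow> enc n L T' n = i \<Longrightarrow> T = T'" "candidate k T S"
      "t2 ''d'' 0 = card (nbrs E p - T)"
      unfolding t1(3) S_def t2_def by blast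
    have t2: "ok k t2" "t2 ''L'' = t1 ''L''" "t2 ''bw'' = s' ''bw''" "t2 ''out'' = s' ''out''"
      using t1 by (simp_all add: t2_def ok_sem sem_frame)
    have f: "feasible {..<n} E p S \<longleftrightarrow> phi (t2 ''d'' 0) S = 0"
      unfolding T(4) using T Lp by (intro candidate_feasible_iff) auto
    have t3: "ok k t3" "t3 ''L'' = t1 ''L''"
      "t3 ''bw'' 0 = (if feasible {..<n} E p S \<and> sum w S < s' ''bw'' 0 then sum w S else s' ''bw'' 0)"
      "?out t3 = (if feasible {..<n} E p S \<and> sum w S < s' ''bw'' 0 then S else ?out s')"
      using t2 sem_record_prog[OF t2(1)] unfolding f by (simp_all add: t3_def ok_sem sem_frame S_def)
    have "\<exists>S. candidate k T' S \<and> (feasible {..<n} E p S \<longrightarrow> t3 ''bw'' 0 \<le> sum w S)"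
      if T': "T' \<subseteq> L" "enc n L T' n < Suc i" for T'
    proof (cases "enc n L T' n = i")
      case True
      then show ?thesis using T(2)[OF T'(1)] T(3) t3(3) by (intro exI[of _ S]) auto
    next
      case False
      then obtain S' where "candidate k T' S'" "feasible {..<n} E p S' \<longrightarrow> s' ''bw'' 0 \<le> sum w S'"
        using I T' by (auto simp: I_def)
      then show ?thesis using t3(3) by (intro exI[of _ S']) auto
    qed
    moreover have "t3 ''bw'' 0 < W \<longrightarrow> feasible {..<n} E p (?out t3) \<and> sum w (?out t3) = t3 ''bw'' 0"
      using I t3(3,4) by (simp add: I_def)
    ultimately have "I (Suc i) t3" using t3 t1 by (simp add: I_def)
    then show ?thesis by (simp add: t3_def t2_def t1_def)
  qed
  ultimately obtain s' where s': "I (s3 ''B'' 0) s'"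
    "sem (LFor ''m'' ''B'' (candidate_prog;; record_prog)) s3 = upd s' ''m'' 0 (s3 ''B'' 0)"
    by (rule sem_for[of I s3 "''B''"])
  have "sem main_prog s0 = upd s' ''m'' 0 (s3 ''B'' 0)"
    using s'(2) by (simp add: main_prog_def s1_def s2_def s3_def del: sem.simps(5))
  then have S: "S = ?out s'" by (simp add: S_def s0_def output_set_def vset_def)
  have I: "I (n ^ Suc (Suc k)) s'" using s'(1) B by simp
  obtain T where T: "T \<subseteq> L" and good: "\<And>S. candidate k T S \<Longrightarrow>
     feasible {..<n} E p S \<and> (n = 1 \<or>
     real (sum w S) \<le> 4 * log 2 (real n) * real (min_weight {..<n} E p w))"
    using exists_good_candidate[OF L] by metis
  have "L \<subseteq> {0..<n}" using Lp nbrs_subset[of p] by auto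
  then have "enc n L T n < 2 ^ card L" using enc_less[of n n L T] by (simp add: Int_absorb2)
  then have "enc n L T n < n ^ Suc (Suc k)" using small by (rule less_le_trans)
  then obtain S' where S': "candidate k T S'" "feasible {..<n} E p S' \<longrightarrow> s' ''bw'' 0 \<le> sum w S'"
    using I T unfolding I_def by blast
  note g = good[OF S'(1)]
  have sub: "S' \<subseteq> {..<n} - {p}" using g by (simp add: feasible_iff)
  have "sum w S' \<le> sum w ({..<n} - {p})" using sub by (intro sum_mono2) auto
  also have "\<dots> < w p + sum w ({..<n} - {p})" using w_pos[OF p_less] by simp
  also have "\<dots> = W" unfolding W_def using p_less by (intro sum.remove[symmetric]) auto
  finally have "sum w S' < W" .
  \<comment> \<open>The record is at most the weight of \<open>S'\<close> and hence below
    \<open>W\<close>, so a feasible set has been recorded.\<close>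
  then have out: "feasible {..<n} E p S" "sum w S \<le> sum w S'"
    using I S' g by (auto simp: I_def S)
  then show "feasible {..<n} E p S" by simp
  show "real (sum w S) \<le> 4 * log 2 (real n) * real (min_weight {..<n} E p w)"
  proof (cases "n = 1")
    case True
    \<comment> \<open>The right-hand side is 0 here, but only the empty set can be output.\<close>
    have "S \<subseteq> {..<n} - {p}" using out(1) by (simp add: feasible_iff)
    then have "S = {}" using True p_less by auto
    then show ?thesis using True by simp
  next
    case False
    have "real (sum w S) \<le> real (sum w S')" using out(2) by (simp only: of_nat_le_iff)
    then show ?thesis using g False by linarith
  qed
qed

text \<open>\<open>exec_compile\<close> is applied twice because \<open>pow_prog\<close> writes
  \<open>B\<close>, a loop bound of \<open>main_prog\<close>. Loop bounds are at most
  \<open>n\<close> in the first part and \<open>n ^ Suc (Suc k)\<close> in the second.\<close>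

lemma exec_program:
  "\<exists>t \<le> cost (pow_prog (Suc (Suc k))) n + cost main_prog (n ^ Suc (Suc k)).
     exec (Seq (compile (pow_prog (Suc (Suc k)))) (compile main_prog)) (input_state n E p w) t
       (sem main_prog (sem (pow_prog (Suc (Suc k))) (input_state n E p w)))"
proof -
  let ?c = "pow_prog (Suc (Suc k))" and ?s = "input_state n E p w"
  have "writes ?c \<inter> bounds ?c = {}" "\<forall>b\<in>bounds ?c. ?s b 0 \<le> n"
    using pow_prog_ok(2,3)[of "Suc (Suc k)"] by (auto simp: input_state_def)
  from exec_compile[of ?c ?s n, OF pow_prog_ok(1) this] obtain t1 where
    t1: "t1 \<le> cost ?c n" "exec (compile ?c) ?s t1 (sem ?c ?s)" by blast
  have "sem ?c ?s ''n'' = ?s ''n''"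
    using pow_prog_ok(2)[of "Suc (Suc k)"] by (intro sem_frame) auto
  then have "sem ?c ?s ''n'' 0 = n" by (simp add: input_state_def)
  moreover have "sem ?c ?s ''B'' 0 = n ^ Suc (Suc k)"
    by (subst sem_pow_prog) (simp add: input_state_def)
  moreover have "n \<le> n ^ Suc (Suc k)" by (rule self_le_power) (use p_less in simp_all)
  ultimately have "\<forall>b\<in>bounds main_prog. sem ?c ?s b 0 \<le> n ^ Suc (Suc k)"
    by (simp add: main_prog_ok(3) del: power_Suc)
  from exec_compile[of main_prog "sem ?c ?s", OF main_prog_ok(1,2) this] obtain t2 where
    t2: "t2 \<le> cost main_prog (n ^ Suc (Suc k))"
    "exec (compile main_prog) (sem ?c ?s) t2 (sem main_prog (sem ?c ?s))" by blast
  show ?thesis using Seq[OF t1(2) t2(2)] t1(1) t2(1) add_mono by blast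
qed

end

text \<open>The time is bounded by a polynomial in \<open>n\<close> alone, whatever the weights, and
  the input size is at least \<open>n * n\<close>.\<close>

lemma polynomial_time_program:
  "polynomial_time (Seq (compile (pow_prog (Suc (Suc k)))) (compile main_prog))"
proof -
  obtain q1 where q1: "\<And>N. cost (pow_prog (Suc (Suc k))) N = poly q1 N" using cost_poly by blast
  obtain q2 where q2: "\<And>N. cost main_prog N = poly q2 N" using cost_poly by blast
  let ?q = "q1 + pcompose q2 (monom 1 (Suc (Suc k)))"
  have "\<exists>t s. exec (Seq (compile (pow_prog (Suc (Suc k)))) (compile main_prog)) (input_state n E p w) t s \<and>
      t \<le> poly ?q (input_size n p w)" if "mdd_instance {..<n} E p w" for n E p w
  proof -
    interpret mdd n E p w using that by unfold_locales
    from exec_program[of k] obtain t s where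
      t: "exec (Seq (compile (pow_prog (Suc (Suc k)))) (compile main_prog)) (input_state n E p w) t s"
      "t \<le> cost (pow_prog (Suc (Suc k))) n + cost main_prog (n ^ Suc (Suc k))" by blast
    note t(2)
    also have "\<dots> = poly ?q n" by (simp add: q1 q2 poly_pcompose poly_monom)
    also have "\<dots> \<le> poly ?q (input_size n p w)"
      by (intro poly_nat_mono) (simp add: input_size_def trans_le_add1 trans_le_add2 le_square)
    finally show ?thesis using t(1) by blast
  qed
  then show ?thesis unfolding polynomial_time_def by blast
qed

text \<open>\<open>2 powr (c * log 2 n)\<close> is \<open>n powr c\<close>, and \<open>c\<close> is
  rounded up. The two extra factors let the same power bound \<open>n * n\<close> and thus the
  potential.\<close>

lemma two_power_le:
  assumes "real m \<le> c * log 2 (real n)" "0 < n"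
  shows "2 ^ m \<le> n ^ Suc (Suc (nat \<lceil>c\<rceil>))"
proof -
  have l: "0 \<le> log 2 (real n)" using assms(2) by simp
  have "real m \<le> c * log 2 (real n)" by (rule assms)
  also have "\<dots> \<le> real (Suc (Suc (nat \<lceil>c\<rceil>))) * log 2 (real n)"
    using l by (intro mult_right_mono) linarith+
  finally have "2 powr real m \<le> 2 powr (real (Suc (Suc (nat \<lceil>c\<rceil>))) * log 2 (real n))" by simp
  also have "\<dots> = real n powr real (Suc (Suc (nat \<lceil>c\<rceil>)))"
    using assms(2) by (simp add: powr_def log_def)
  finally have "(2 :: real) ^ m \<le> real n ^ Suc (Suc (nat \<lceil>c\<rceil>))"
    using assms(2) by (simp only: powr_realpow of_nat_0_less_iff zero_less_numeral)
  then have "real (2 ^ m) \<le> real (n ^ Suc (Suc (nat \<lceil>c\<rceil>)))" by simp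
  then show ?thesis by (simp only: of_nat_le_iff)
qed

theorem theorem8:
  fixes c :: real
  assumes "c > 0"
  shows "\<exists>(A :: com) (C :: real). polynomial_time A \<and> C > 0 \<and>
    (\<forall>n E p w L. mdd_instance {..<n} E p w \<longrightarrow> L_produced E p L \<longrightarrow>
       real (card L) \<le> c * log 2 (real n) \<longrightarrow>
       (\<exists>S. outputs A n E p w S \<and> feasible {..<n} E p S \<and>
          real (sum w S) \<le> C * log 2 (real n) * real (min_weight {..<n} E p w)))"
proof -
  \<comment> \<open>The program depends on \<open>c\<close> only through \<open>k\<close>; the
    approximation constant 4 does not depend on \<open>c\<close>.\<close>
  define k where "k = nat \<lceil>c\<rceil>"
  let ?A = "Seq (compile (pow_prog (Suc (Suc k)))) (compile main_prog)"
  have "\<exists>S. outputs ?A n E p w S \<and> feasible {..<n} E p S \<and>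
          real (sum w S) \<le> 4 * log 2 (real n) * real (min_weight {..<n} E p w)"
    if "mdd_instance {..<n} E p w" "L_produced E p L" "real (card L) \<le> c * log 2 (real n)" for n E p w L
  proof -
    interpret mdd n E p w using that(1) by unfold_locales
    have "2 ^ card L \<le> n ^ Suc (Suc k)"
      unfolding k_def using that(3) p_less by (intro two_power_le) auto
    note main_prog_correct[OF that(2) this]
    moreover have "outputs ?A n E p w
        (output_set n (sem main_prog (sem (pow_prog (Suc (Suc k))) (input_state n E p w))))"
      unfolding outputs_def using exec_program[of k] by blast
    ultimately show ?thesis by blast
  qed
  then show ?thesis using polynomial_time_program[of k]
    by (intro exI[of _ ?A] exI[of _ 4] conjI allI impI) simp_all
qed

end
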